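(* Let $\alpha$ be $S^-$-admissible, $(a,b)$ be an $\alpha$-compatible pair, $r\in\mathbb{N}^*$, and $N=N(\alpha,a,b)$. The quotient $\mathscr{C}_{a,b,r}/\mathcal{G}_{(a,b)}$, which parameterises the connected components of the fibre $\Phi_{\alpha,r}^{-1}([(a,b)])=\Psi_{\alpha,r}^{-1}([N(\alpha,a,b)])$ (the orbit of $[c]_{ab}$ corresponding to the class of $(a,b,[c]_{ab})$; these components are points, so that this quotient is identified with the fibre itself), can be naturally identified, via the map $c\mapsto p(a,b,c,r)$, with the quotient of $$\mathbb{Z}_{N,r}:=\mathbb{Z}^2/\big((I_2+N)\mathbb{Z}^2+r\mathbb{Z}^2\big)$$ by the group $Z^+_{\mathrm{GL}(2,\mathbb{Z})}(N)$ acting on $\mathbb{Z}_{N,r}$ by $K*[p]:=[\varepsilon_KKp]$, where $\varepsilon_K=\det(K)$.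
   Context: $\mathbb{N}^*=\{1,2,\dots\}$. For $x,y\in\mathbb{R}^2$, $x\wedge y=x_1y_2-x_2y_1$. Elements of $\mathbb{R}^2$ are columns; $k=(k_1,k_2)\in\mathbb{Z}^2$ in the action (ii) below is treated as a row, so $ka=k_1a_1+k_2a_2$. $\alpha$ is $S^-$-admissible if $\alpha=\frac{\theta+\sqrt{\theta^2+4}}{2}$ with $\theta\in\mathbb{N}^*$. Put $\mathbb{Z}_\theta=\mathbb{Z}/\theta\mathbb{Z}$. $\mathcal{P}^-_\alpha$ is the set of linearly independent pairs $(a,b)\in\mathbb{R}^2\times\mathbb{R}^2$ that are $\alpha$-compatible, i.e. such that $N=(n_{ij})=N(\alpha,a,b):=Q\,\mathrm{diag}(\alpha,-\alpha^{-1})Q^{-1}\in M_2(\mathbb{Z})$, $Q$ being the matrix with columns $a,b$. $\mathcal{N}^-_\alpha=\{N\in\mathrm{GL}(2,\mathbb{Z})\mid\det(N)=-1,\ \alpha\in\mathrm{Spec}(N)\}$, and $\sim$ is conjugation by $\mathrm{GL}(2,\mathbb{Z})$. For $(a,b)\in\mathcal{P}^-_\alpha$, $r\in\mathbb{N}^*$, $\mathcal{C}_{a,b,r}$ is the set of $c\in\mathbb{R}^2$ for which there is $p=p(a,b,c,r)\in\mathbb{Z}^2$ with $$(I_2+N)\Big(c-\tfrac12\begin{pmatrix}a_1b_1\\ a_2b_2\end{pmatrix}\Big)-\tfrac{a\wedge b}{2}\begin{pmatrix}n_{11}n_{12}\\ n_{21}n_{22}\end{pmatrix}=\tfrac{a\wedge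 b}{r}\,p(a,b,c,r).$$ $\mathcal{T}_{\alpha,r}$ is the set of triples $(a,b,c)$ with $(a,b)\in\mathcal{P}^-_\alpha$, $c\in\mathcal{C}_{a,b,r}$, with the coarsest topology making $(a,b,c)\mapsto N(\alpha,a,b)$, $(a,b,c)\mapsto p(a,b,c,r)$ (discrete targets) and $(a,b,c)\mapsto(a,b)$ continuous. Put $[c]_{ab}=c+\frac{b\wedge a}{r}\mathbb{Z}^2$, $\mathscr{C}_{a,b,r}=\mathcal{C}_{a,b,r}/\frac{b\wedge a}{r}\mathbb{Z}^2$, and let $\mathscr{T}_{\alpha,r}$ be the set of all $(a,b,[c]_{ab})$ with $(a,b,c)\in\mathcal{T}_{\alpha,r}$, with the quotient topology. (The points of $\mathcal{T}_{\alpha,r}$ are the parameters, for fixed $\alpha,r$, of the type III Inoue surfaces $S^{\alpha,r}_{a,b,c}$.) Actions on $\mathscr{T}_{\alpha,r}$ (all well defined): (i) $K=(k_{ij})\in\mathrm{GL}(2,\mathbb{Z})$: $K\cdot(a,b,[c]_{ab})=(A,B,[C]_{AB})$, $A=Ka$, $B=Kb$, $C=\tfrac12\begin{pmatrix}A_1B_1\\ A_2B_2\end{pmatrix}+K\big(c-\tfrac12\begin{pmatrix}a_1b_1\\ a_2b_2\end{pmatrix}\big)+\tfrac{b\wedge a}{2}\begin{pmatrix}k_{11}k_{12}\\ k_{21}k_{22}\end{pmatrix}$. (ii) $k\in\mathbb{Z}^2$: $k\cdot(a,b,[c]_{ab})=(a,b,[k\cdot c]_{ab})$, $k\cdot c=c+\tfrac{kb}{1+\alpha}a+\tfrac{\alpha(ka)}{1-\alpha}b$;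 this descends to an action of $\mathbb{Z}_\theta^2=\mathbb{Z}^2/\theta\mathbb{Z}^2$. (iii) $(\mu,\rho)\in\mathbb{R}^*_+\times\mathbb{R}^*$: $(a,b,[c]_{ab})\mapsto(\mu a,\rho b,[\mu\rho c]_{\mu a,\rho b})$. Let $\mathcal{G}=(\mathbb{R}^*_+\times\mathbb{R}^* )\times(\mathrm{GL}(2,\mathbb{Z})\ltimes_\psi\mathbb{Z}_\theta^2)$, where the semidirect product has the law $(K,[k])*(K',[k'])=(KK',[kK'+k'])$. $\mathcal{G}$ acts on $\mathscr{T}_{\alpha,r}$ by $((\mu,\rho),(K,[k]))\cdot x=K\cdot(k\cdot((\mu,\rho)\cdot x))$, on $\mathcal{P}^-_\alpha$ by $(a,b)\mapsto(\mu Ka,\rho Kb)$, and on $\mathcal{N}^-_\alpha$ by $N\mapsto KNK^{-1}$. $\mathscr{Q}^-_{\alpha,r}=\mathscr{T}_{\alpha,r}/\mathcal{G}$ has the quotient topology. $\Phi_{\alpha,r}:\mathscr{Q}^-_{\alpha,r}\to\mathcal{P}^-_\alpha/\mathcal{G}$ and $\Psi_{\alpha,r}:\mathscr{Q}^-_{\alpha,r}\to\mathcal{N}^-_\alpha/\!\sim$ are induced by $(a,b,[c]_{ab})\mapsto(a,b)$ and $(a,b,[c]_{ab})\mapsto N(\alpha,a,b)$. $\mathcal{G}_{(a,b)}$ is the stabiliser of $(a,b)\in\mathcal{P}^-_\alpha$; it acts on $\mathscr{C}_{a,b,r}$ through its action on the third component of elements $(a,b,[c]_{ab})$. The positive centraliser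 is $Z^+_{\mathrm{GL}(2,\mathbb{Z})}(N)=\{K\in\mathrm{GL}(2,\mathbb{Z})\mid KN=NK,\ Ka\in\mathbb{R}^*_+a\}$. *)

theory Defs
  imports "HOL-Analysis.Analysis" "HOL-Algebra.Group_Action"
begin

definition wedge :: "real^2 \<Rightarrow> real^2 \<Rightarrow> real" where
  "wedge x y = x$1 * y$2 - x$2 * y$1"

definition vec_of_int :: "int^2 \<Rightarrow> real^2" where
  "vec_of_int k = (\<chi> i. of_int (k$i))"

abbreviation mat_of_int :: "int^2^2 \<Rightarrow> real^2^2" where
  "mat_of_int \<equiv> map_matrix of_int"

definition row_times :: "int^2 \<Rightarrow> real^2 \<Rightarrow> real" where
  "row_times k a = (\<Sum>i\<in>UNIV. of_int (k$i) * a$i)"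

definition comp_mult :: "real^2 \<Rightarrow> real^2 \<Rightarrow> real^2" where
  "comp_mult a b = (\<chi> i. a$i * b$i)"

definition row_prods :: "int^2^2 \<Rightarrow> int^2" where
  "row_prods M = (\<chi> i. M$i$1 * M$i$2)"

definition add_group :: "'a::ab_group_add monoid" where
  "add_group = \<lparr>carrier = UNIV, mult = (+), one = 0\<rparr>"

definition quotient_topology :: "'a topology \<Rightarrow> ('a \<Rightarrow> 'b) \<Rightarrow> 'b topology" where
  "quotient_topology X q =
     topology (\<lambda>U. U \<subseteq> q ` topspace X \<and> openin X {x \<in> topspace X. q x \<in> U})"

lemma quotient_topology_quotient_map: "quotient_map X (quotient_topology X q) q"
proof -
  define P where "P = (\<lambda>U. U \<subseteq> q ` topspace X \<and> openin X {x \<in> topspace X. q x \<in> U})"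
  have int: "P (S \<inter> T)" if "P S" "P T" for S T
  proof -
    have "{x \<in> topspace X. q x \<in> S \<inter> T} = {x \<in> topspace X. q x \<in> S} \<inter> {x \<in> topspace X. q x \<in> T}"
      by auto
    then show ?thesis using that by (auto simp: P_def)
  qed
  have un: "P (\<Union>K)" if "\<And>S. S \<in> K \<Longrightarrow> P S" for K
  proof -
    have "{x \<in> topspace X. q x \<in> \<Union>K} = (\<Union>S\<in>K. {x \<in> topspace X. q x \<in> S})" by auto
    then show ?thesis using that by (fastforce simp: P_def)
  qed
  have "istopology P"
    unfolding istopology_def using int un by auto
  then have op: "openin (quotient_topology X q) U \<longleftrightarrow> P U" for U
    unfolding quotient_topology_def P_def[symmetric] by (simp add: topology_inverse')
  have "P (q ` topspace X)"
  proof -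
    have "{x \<in> topspace X. q x \<in> q ` topspace X} = topspace X" by auto
    then show ?thesis by (simp add: P_def)
  qed
  moreover have "U \<subseteq> q ` topspace X" if "P U" for U
    using that by (simp add: P_def)
  ultimately have "topspace (quotient_topology X q) = q ` topspace X"
    unfolding topspace_def[of "quotient_topology X q"] op by blast
  then show ?thesis
    unfolding quotient_map_def op by (auto simp: P_def)
qed

definition S_minus_admissible_with :: "nat \<Rightarrow> real \<Rightarrow> bool" where
  "S_minus_admissible_with \<theta> \<alpha> \<longleftrightarrow> \<theta> \<ge> 1 \<and> \<alpha> = (real \<theta> + sqrt ((real \<theta>)\<^sup>2 + 4)) / 2"

definition S_minus_admissible :: "real \<Rightarrow> bool" where
  "S_minus_admissible \<alpha> \<longleftrightarrow> (\<exists>\<theta>. S_minus_admissible_with \<theta> \<alpha>)"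

definition theta_of :: "real \<Rightarrow> nat" where
  "theta_of \<alpha> = (THE \<theta>. S_minus_admissible_with \<theta> \<alpha>)"

lemma admissible_facts:
  assumes "S_minus_admissible_with \<theta> \<alpha>"
  shows "\<alpha> > 1" "real \<theta> = \<alpha> - 1 / \<alpha>"
proof -
  define s where "s = sqrt ((real \<theta>)\<^sup>2 + 4)"
  have s2: "s\<^sup>2 = (real \<theta>)\<^sup>2 + 4" unfolding s_def by simp
  have s0: "s > sqrt 1" unfolding s_def by (subst real_sqrt_less_iff) (smt (verit) zero_le_power2)
  have al: "\<alpha> = (real \<theta> + s) / 2" and th: "\<theta> \<ge> 1"
    using assms by (simp_all add: S_minus_admissible_with_def s_def)
  show al1: "\<alpha> > 1" using s0 th by (simp add: al)
  have "\<alpha> * \<alpha> - real \<theta> * \<alpha> = 1"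
    unfolding al using s2 by (simp add: field_simps power2_eq_square)
  with al1 show "real \<theta> = \<alpha> - 1 / \<alpha>" by (simp add: field_simps)
qed

lemma theta_of_eq:
  assumes "S_minus_admissible_with \<theta> \<alpha>"
  shows "theta_of \<alpha> = \<theta>"
  unfolding theta_of_def
proof (rule the_equality)
  show "t = \<theta>" if "S_minus_admissible_with t \<alpha>" for t
    using admissible_facts(2)[OF that] admissible_facts(2)[OF assms] by simp
qed (rule assms)

definition N_real :: "real \<Rightarrow> real^2 \<Rightarrow> real^2 \<Rightarrow> real^2^2" where
  "N_real \<alpha> a b =
     (let Q = transpose (vector [a, b] :: real^2^2)
      in Q ** vector [vector [\<alpha>, 0], vector [0, - inverse \<alpha>]] ** matrix_inv Q)"

text \<open>\<open>N_of \<alpha> a b\<close> is the matrix $N(\alpha,a,b)$, regarded as an integer matrix. It is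
  meaningful only for compatible pairs.\<close>

definition N_of :: "real \<Rightarrow> real^2 \<Rightarrow> real^2 \<Rightarrow> int^2^2" where
  "N_of \<alpha> a b = (THE N. mat_of_int N = N_real \<alpha> a b)"

definition P_minus :: "real \<Rightarrow> ((real^2) \<times> (real^2)) set" where
  "P_minus \<alpha> = {(a, b). a \<noteq> b \<and> independent {a, b} \<and> (\<exists>N. mat_of_int N = N_real \<alpha> a b)}"

definition N_minus :: "real \<Rightarrow> (int^2^2) set" where
  "N_minus \<alpha> = {N. invertible N \<and> det N = -1 \<and> (\<exists>v. v \<noteq> 0 \<and> mat_of_int N *v v = \<alpha> *\<^sub>R v)}"

definition c_equation :: "real \<Rightarrow> nat \<Rightarrow> real^2 \<Rightarrow> real^2 \<Rightarrow> real^2 \<Rightarrow> int^2 \<Rightarrow> bool" where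
  "c_equation \<alpha> r a b c p \<longleftrightarrow>
     (mat 1 + mat_of_int (N_of \<alpha> a b)) *v (c - (1/2) *\<^sub>R comp_mult a b)
       - (wedge a b / 2) *\<^sub>R vec_of_int (row_prods (N_of \<alpha> a b))
     = (wedge a b / real r) *\<^sub>R vec_of_int p"

definition C_set :: "real \<Rightarrow> nat \<Rightarrow> real^2 \<Rightarrow> real^2 \<Rightarrow> (real^2) set" where
  "C_set \<alpha> r a b = {c. \<exists>p. c_equation \<alpha> r a b c p}"

definition p_of :: "real \<Rightarrow> nat \<Rightarrow> real^2 \<Rightarrow> real^2 \<Rightarrow> real^2 \<Rightarrow> int^2" where
  "p_of \<alpha> r a b c = (THE p. c_equation \<alpha> r a b c p)"

definition T_set :: "real \<Rightarrow> nat \<Rightarrow> ((real^2) \<times> (real^2) \<times> (real^2)) set" where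
  "T_set \<alpha> r = {(a, b, c). (a, b) \<in> P_minus \<alpha> \<and> c \<in> C_set \<alpha> r a b}"

definition T_top :: "real \<Rightarrow> nat \<Rightarrow> ((real^2) \<times> (real^2) \<times> (real^2)) topology" where
  "T_top \<alpha> r = topology_generated_by
     (range (\<lambda>U. {(a, b, c) \<in> T_set \<alpha> r. N_of \<alpha> a b \<in> U})
      \<union> range (\<lambda>U. {(a, b, c) \<in> T_set \<alpha> r. p_of \<alpha> r a b c \<in> U})
      \<union> (\<lambda>U. {(a, b, c) \<in> T_set \<alpha> r. (a, b) \<in> U}) ` {U. open U})"

definition c_lattice :: "nat \<Rightarrow> real^2 \<Rightarrow> real^2 \<Rightarrow> (real^2) set" where
  "c_lattice r a b = range (\<lambda>m. (wedge b a / real r) *\<^sub>R vec_of_int m)"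

definition c_class :: "nat \<Rightarrow> real^2 \<Rightarrow> real^2 \<Rightarrow> real^2 \<Rightarrow> (real^2) set" where
  "c_class r a b c = c_lattice r a b #>\<^bsub>add_group\<^esub> c"

definition C_quot :: "real \<Rightarrow> nat \<Rightarrow> real^2 \<Rightarrow> real^2 \<Rightarrow> (real^2) set set" where
  "C_quot \<alpha> r a b = c_class r a b ` C_set \<alpha> r a b"

type_synonym point = "(real^2) \<times> (real^2) \<times> (real^2) set"

definition T_proj :: "nat \<Rightarrow> (real^2) \<times> (real^2) \<times> (real^2) \<Rightarrow> point" where
  "T_proj r = (\<lambda>(a, b, c). (a, b, c_class r a b c))"

definition T_quot :: "real \<Rightarrow> nat \<Rightarrow> point set" where
  "T_quot \<alpha> r = T_proj r ` T_set \<alpha> r"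

definition T_quot_top :: "real \<Rightarrow> nat \<Rightarrow> point topology" where
  "T_quot_top \<alpha> r = quotient_topology (T_top \<alpha> r) (T_proj r)"

definition GL2Z :: "(int^2^2) monoid" where
  "GL2Z = \<lparr>carrier = {K. invertible K}, mult = (**), one = mat 1\<rparr>"

definition theta_lattice :: "nat \<Rightarrow> (int^2) set" where
  "theta_lattice \<theta> = range (\<lambda>m. int \<theta> *s m)"

definition Z_theta2 :: "nat \<Rightarrow> (int^2) set monoid" where
  "Z_theta2 \<theta> = add_group Mod theta_lattice \<theta>"

text \<open>An element of \<open>Z_theta2 \<theta>\<close> is a coset \<open>\<kappa>\<close>; the class of $kK'$, for $k$ in \<open>\<kappa>\<close>, is the
  image of \<open>\<kappa>\<close> under right multiplication by the invertible matrix $K'$.\<close>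

definition semidirect_group :: "nat \<Rightarrow> ((int^2^2) \<times> (int^2) set) monoid" where
  "semidirect_group \<theta> =
     \<lparr>carrier = carrier GL2Z \<times> carrier (Z_theta2 \<theta>),
      mult = (\<lambda>(K, \<kappa>) (K', \<kappa>'). (K \<otimes>\<^bsub>GL2Z\<^esub> K', ((\<lambda>k. k v* K') ` \<kappa>) \<otimes>\<^bsub>Z_theta2 \<theta>\<^esub> \<kappa>')),
      one = (\<one>\<^bsub>GL2Z\<^esub>, \<one>\<^bsub>Z_theta2 \<theta>\<^esub>)\<rparr>"

definition pos_reals_group :: "real monoid" where
  "pos_reals_group = \<lparr>carrier = {0<..}, mult = (*), one = 1\<rparr>"

definition nonzero_reals_group :: "real monoid" where
  "nonzero_reals_group = \<lparr>carrier = - {0}, mult = (*), one = 1\<rparr>"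

type_synonym G_elt = "(real \<times> real) \<times> (int^2^2) \<times> (int^2) set"

definition G_group :: "real \<Rightarrow> G_elt monoid" where
  "G_group \<alpha> = (pos_reals_group \<times>\<times> nonzero_reals_group) \<times>\<times> semidirect_group (theta_of \<alpha>)"

text \<open>Since classes are cosets, the actions of $\mathrm{GL}(2,\mathbb{Z})$, $\mathbb{Z}_\theta^2$ and
  $\mathbb{R}^*_+\times\mathbb{R}^*$ on classes are defined below by taking images of cosets. The lemmas
  \<open>GL_act_class\<close>, \<open>trans_act_class\<close> and \<open>scale_act_class\<close> show that this agrees with
  the formulas on representatives.\<close>

definition GL_rep :: "int^2^2 \<Rightarrow> real^2 \<Rightarrow> real^2 \<Rightarrow> real^2 \<Rightarrow> real^2" where
  "GL_rep K a b c =
     (1/2) *\<^sub>R comp_mult (mat_of_int K *v a) (mat_of_int K *v b)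
     + mat_of_int K *v (c - (1/2) *\<^sub>R comp_mult a b)
     + (wedge b a / 2) *\<^sub>R vec_of_int (row_prods K)"

definition GL_act :: "int^2^2 \<Rightarrow> point \<Rightarrow> point" where
  "GL_act K = (\<lambda>(a, b, \<gamma>). (mat_of_int K *v a, mat_of_int K *v b, GL_rep K a b ` \<gamma>))"

definition trans_rep :: "real \<Rightarrow> int^2 \<Rightarrow> real^2 \<Rightarrow> real^2 \<Rightarrow> real^2 \<Rightarrow> real^2" where
  "trans_rep \<alpha> k a b c =
     c + (row_times k b / (1 + \<alpha>)) *\<^sub>R a + (\<alpha> * row_times k a / (1 - \<alpha>)) *\<^sub>R b"

definition trans_act :: "real \<Rightarrow> (int^2) set \<Rightarrow> point \<Rightarrow> point" where
  "trans_act \<alpha> \<kappa> = (\<lambda>(a, b, \<gamma>). (a, b, \<Union>k\<in>\<kappa>. trans_rep \<alpha> k a b ` \<gamma>))"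

definition scale_act :: "real \<Rightarrow> real \<Rightarrow> point \<Rightarrow> point" where
  "scale_act \<mu> \<rho> = (\<lambda>(a, b, \<gamma>). (\<mu> *\<^sub>R a, \<rho> *\<^sub>R b, (*\<^sub>R) (\<mu> * \<rho>) ` \<gamma>))"

definition G_act_T :: "real \<Rightarrow> nat \<Rightarrow> G_elt \<Rightarrow> point \<Rightarrow> point" where
  "G_act_T \<alpha> r = (\<lambda>((\<mu>, \<rho>), (K, \<kappa>)).
     \<lambda>x\<in>T_quot \<alpha> r. GL_act K (trans_act \<alpha> \<kappa> (scale_act \<mu> \<rho> x)))"

definition G_act_P :: "real \<Rightarrow> G_elt \<Rightarrow> (real^2) \<times> (real^2) \<Rightarrow> (real^2) \<times> (real^2)" where
  "G_act_P \<alpha> = (\<lambda>((\<mu>, \<rho>), (K, \<kappa>)).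
     \<lambda>(a, b)\<in>P_minus \<alpha>. (\<mu> *\<^sub>R (mat_of_int K *v a), \<rho> *\<^sub>R (mat_of_int K *v b)))"

definition conj_act :: "real \<Rightarrow> int^2^2 \<Rightarrow> int^2^2 \<Rightarrow> int^2^2" where
  "conj_act \<alpha> K = (\<lambda>N\<in>N_minus \<alpha>. K ** N ** matrix_inv K)"

lemma c_class_eq: "c_class r a b c = {c + (wedge b a / real r) *\<^sub>R vec_of_int m |m. True}"
  by (auto simp: c_class_def c_lattice_def r_coset_def add_group_def add.commute)

lemma wedge_scaleR: "wedge (\<mu> *\<^sub>R x) (\<rho> *\<^sub>R y) = \<mu> * \<rho> * wedge x y"
  by (simp add: wedge_def algebra_simps)

lemma wedge_mult: "wedge (mat_of_int K *v x) (mat_of_int K *v y) = of_int (det K) * wedge x y"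
  by (simp add: wedge_def matrix_vector_mult_def sum_2 det_2 algebra_simps)

lemma vec_of_int_add: "vec_of_int (m + n) = vec_of_int m + vec_of_int n"
  by (simp add: vec_of_int_def vec_eq_iff)

lemma vec_of_int_scale: "vec_of_int (k *s m) = of_int k *\<^sub>R vec_of_int m"
  by (simp add: vec_of_int_def vec_eq_iff)

lemma vec_of_int_mult: "vec_of_int (K *v m) = mat_of_int K *v vec_of_int m"
  by (simp add: vec_of_int_def vec_eq_iff matrix_vector_mult_def)

lemma scale_act_class:
  "scale_act \<mu> \<rho> (a, b, c_class r a b c)
   = (\<mu> *\<^sub>R a, \<rho> *\<^sub>R b, c_class r (\<mu> *\<^sub>R a) (\<rho> *\<^sub>R b) ((\<mu> * \<rho>) *\<^sub>R c))"
proof -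
  have "(\<mu> * \<rho>) *\<^sub>R (c + (wedge b a / real r) *\<^sub>R m)
     = (\<mu> * \<rho>) *\<^sub>R c + (wedge (\<rho> *\<^sub>R b) (\<mu> *\<^sub>R a) / real r) *\<^sub>R m" for m
    by (simp add: wedge_scaleR scaleR_add_right mult.commute)
  then show ?thesis
    unfolding scale_act_def c_class_eq by (auto simp: image_iff) metis+
qed

lemma GL_act_class:
  assumes "invertible K"
  shows "GL_act K (a, b, c_class r a b c)
    = (mat_of_int K *v a, mat_of_int K *v b,
       c_class r (mat_of_int K *v a) (mat_of_int K *v b) (GL_rep K a b c))"
proof -
  let ?W = "wedge (mat_of_int K *v b) (mat_of_int K *v a) / real r"
  obtain L where L: "K ** L = mat 1" "L ** K = mat 1"
    using assms unfolding invertible_def by blast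
  have "det K * det L = 1" using L by (metis det_I det_mul)
  then have d: "det K * det K = 1" by (metis zmult_eq_1_iff mult_minus_left mult_minus_right mult_1 minus_minus)
  have dR: "of_int (det K) * of_int (det K) = (1::real)" using d by (metis of_int_1 of_int_mult)
  have rep: "GL_rep K a b (c + (wedge b a / real r) *\<^sub>R vec_of_int m)
     = GL_rep K a b c + (wedge b a / real r) *\<^sub>R vec_of_int (K *v m)" for m
    by (simp add: GL_rep_def vec_of_int_mult matrix_vector_right_distrib
        matrix_vector_mult_diff_distrib matrix_vector_mult_scaleR)
  have W: "?W = of_int (det K) * (wedge b a / real r)" by (simp add: wedge_mult)
  have W': "wedge b a / real r = of_int (det K) * ?W"
    unfolding W using dR by (simp add: mult.assoc[symmetric])
  have 1: "(wedge b a / real r) *\<^sub>R vec_of_int (K *v m) = ?W *\<^sub>R vec_of_int (det K *s (K *v m))" for m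
    by (subst W') (simp add: vec_of_int_scale mult.commute)
  have 2: "?W *\<^sub>R vec_of_int n
      = (wedge b a / real r) *\<^sub>R vec_of_int (K *v (L *v (det K *s n)))" for n
    by (simp add: W matrix_vector_mul_assoc L vec_of_int_scale mult.commute)
  have "GL_rep K a b ` c_class r a b c
      = c_class r (mat_of_int K *v a) (mat_of_int K *v b) (GL_rep K a b c)"
  proof (intro equalityI subsetI)
    fix x assume "x \<in> GL_rep K a b ` c_class r a b c"
    then obtain m where "x = GL_rep K a b (c + (wedge b a / real r) *\<^sub>R vec_of_int m)"
      unfolding c_class_eq by blast
    then show "x \<in> c_class r (mat_of_int K *v a) (mat_of_int K *v b) (GL_rep K a b c)"
      unfolding c_class_eq rep 1 by blast
  next
    fix x assume "x \<in> c_class r (mat_of_int K *v a) (mat_of_int K *v b) (GL_rep K a b c)"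
    then obtain n where "x = GL_rep K a b c + ?W *\<^sub>R vec_of_int n"
      unfolding c_class_eq by blast
    then have "x = GL_rep K a b (c + (wedge b a / real r) *\<^sub>R vec_of_int (L *v (det K *s n)))"
      by (simp only: 2 rep)
    then show "x \<in> GL_rep K a b ` c_class r a b c"
      unfolding c_class_eq by blast
  qed
  then show ?thesis by (simp add: GL_act_def)
qed

lemma N_real_facts:
  assumes "a \<noteq> b" "independent {a, b}" "\<alpha> \<noteq> 0"
  shows "N_real \<alpha> a b *v a = \<alpha> *\<^sub>R a"
    and "N_real \<alpha> a b *v b = (- inverse \<alpha>) *\<^sub>R b"
    and "det (mat 1 + N_real \<alpha> a b) = \<alpha> - 1 / \<alpha>"
    and "wedge a b \<noteq> 0"
proof -
  define Q where "Q = (transpose (vector [a, b]) :: real^2^2)"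
  define D where "D = (vector [vector [\<alpha>, 0], vector [0, - inverse \<alpha>]] :: real^2^2)"
  have N: "N_real \<alpha> a b = Q ** D ** matrix_inv Q"
    by (simp add: N_real_def Q_def D_def Let_def)
  have dQ: "det Q = wedge a b"
    by (simp add: Q_def wedge_def det_2 transpose_def vector_2 mult.commute)
  show w: "wedge a b \<noteq> 0"
  proof
    assume "wedge a b = 0"
    then have eq: "a$1 * b$2 = a$2 * b$1" by (simp add: wedge_def)
    have nz: "a \<noteq> 0" using assms(2) dependent_zero by blast
    have rel: "(b$i) *\<^sub>R a = (a$i) *\<^sub>R b" for i
      using eq exhaust_2[of i] by (auto simp: vec_eq_iff forall_2 mult.commute)
    obtain i where i: "a$i \<noteq> 0" using nz by (auto simp: vec_eq_iff)
    have "b = inverse (a$i) *\<^sub>R ((a$i) *\<^sub>R b)" using i by simp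
    also have "\<dots> = (b$i / a$i) *\<^sub>R a" by (simp add: rel[symmetric] divide_inverse mult.commute)
    finally have "b \<in> span {a}" by (metis insertI1 span_base span_scale)
    then have "dependent {a, b}"
      using assms(1) unfolding dependent_def by (intro bexI[of _ b]) (auto simp: insert_Diff_if)
    then show False using assms(2) by simp
  qed
  have inv: "matrix_inv Q ** Q = mat 1" "Q ** matrix_inv Q = mat 1"
  proof -
    have "\<exists>B. Q ** B = mat 1 \<and> B ** Q = mat 1"
      using w dQ invertible_det_nz[of Q] by (simp add: invertible_def)
    then have "Q ** matrix_inv Q = mat 1 \<and> matrix_inv Q ** Q = mat 1"
      unfolding matrix_inv_def by (rule someI_ex)
    then show "matrix_inv Q ** Q = mat 1" "Q ** matrix_inv Q = mat 1" by auto
  qed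
  have e1: "Q *v axis 1 1 = a" and e2: "Q *v axis 2 1 = b"
    by (auto simp: Q_def vec_eq_iff matrix_vector_mult_def sum_2 forall_2 axis_def transpose_def vector_2)
  have d1: "D *v axis 1 1 = \<alpha> *\<^sub>R axis 1 1" and d2: "D *v axis 2 1 = (- inverse \<alpha>) *\<^sub>R axis 2 1"
    by (auto simp: D_def vec_eq_iff matrix_vector_mult_def sum_2 forall_2 axis_def vector_2)
  have NQ: "N_real \<alpha> a b *v (Q *v x) = Q *v (D *v x)" for x
    unfolding N by (simp add: matrix_vector_mul_assoc matrix_mul_assoc[symmetric] inv)
  show "N_real \<alpha> a b *v a = \<alpha> *\<^sub>R a" "N_real \<alpha> a b *v b = (- inverse \<alpha>) *\<^sub>R b"
    using NQ[of "axis 1 1"] NQ[of "axis 2 1"] by (simp_all only: e1 e2 d1 d2 matrix_vector_mult_scaleR)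
  have "mat 1 + N_real \<alpha> a b = Q ** (mat 1 + D) ** matrix_inv Q"
  proof -
    have "Q ** (mat 1 + D) = Q + Q ** D" by (simp add: matrix_add_ldistrib)
    moreover have "(Q + X) ** Y = Q ** Y + X ** Y" for X Y :: "real^2^2"
      by (simp add: matrix_matrix_mult_def vec_eq_iff sum.distrib distrib_right)
    ultimately show ?thesis unfolding N by (simp add: inv)
  qed
  then have "det (mat 1 + N_real \<alpha> a b) = det (mat 1 + D) * (det Q * det (matrix_inv Q))"
    by (simp add: det_mul)
  also have "det Q * det (matrix_inv Q) = 1" by (metis det_mul inv(2) det_I)
  also have "det (mat 1 + D) = (1 + \<alpha>) * (1 - inverse \<alpha>)"
    by (simp add: det_2 D_def mat_def vector_2)
  also have "\<dots> = \<alpha> - 1 / \<alpha>" using assms(3) by (simp add: field_simps)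
  finally show "det (mat 1 + N_real \<alpha> a b) = \<alpha> - 1 / \<alpha>" by simp
qed

lemma N_of_eq:
  assumes "(a, b) \<in> P_minus \<alpha>"
  shows "mat_of_int (N_of \<alpha> a b) = N_real \<alpha> a b"
proof -
  have "\<exists>!N. mat_of_int N = N_real \<alpha> a b"
    using assms by (auto simp: P_minus_def vec_eq_iff)
       (metis of_int_eq_iff)
  then show ?thesis unfolding N_of_def by (rule theI')
qed

lemma trans_act_class:
  assumes adm: "S_minus_admissible \<alpha>" and ab: "(a, b) \<in> P_minus \<alpha>" and r: "r \<ge> 1"
  shows "trans_act \<alpha> (theta_lattice (theta_of \<alpha>) #>\<^bsub>add_group\<^esub> k) (a, b, c_class r a b c)
    = (a, b, c_class r a b (trans_rep \<alpha> k a b c))"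
proof -
  obtain \<theta> where th: "S_minus_admissible_with \<theta> \<alpha>" using adm by (auto simp: S_minus_admissible_def)
  have th_of: "theta_of \<alpha> = \<theta>" by (rule theta_of_eq[OF th])
  have al: "\<alpha> > 1" and thR: "real \<theta> = \<alpha> - 1 / \<alpha>"
    using admissible_facts[OF th] by auto
  define M where "M = mat 1 + N_of \<alpha> a b"
  have MR: "mat_of_int M = mat 1 + N_real \<alpha> a b"
    by (simp add: M_def N_of_eq[OF ab, symmetric] vec_eq_iff mat_def)
  have ind: "a \<noteq> b" "independent {a, b}" using ab by (auto simp: P_minus_def)
  note F = N_real_facts[OF ind, of \<alpha>]
  define s where "s = (\<lambda>k. (row_times k b / (1 + \<alpha>)) *\<^sub>R a + (\<alpha> * row_times k a / (1 - \<alpha>)) *\<^sub>R b)"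
  have s_add: "s (k + l) = s k + s l" for k l
    by (simp add: s_def row_times_def sum_2 algebra_simps add_divide_distrib)
  have tr: "trans_rep \<alpha> k a b c = c + s k" for k c
    by (simp add: trans_rep_def s_def)
  define J where "J = (\<lambda>k :: int^2. vector [k$2, - k$1] :: int^2)"
  define A where "A = (vector [vector [M$2$2, - M$1$2], vector [- M$2$1, M$1$1]] :: int^2^2)"
  have Ms: "mat_of_int M *v s k = wedge a b *\<^sub>R vec_of_int (J k)" for k
  proof -
    have "mat_of_int M *v s k
      = (row_times k b / (1 + \<alpha>)) *\<^sub>R ((1 + \<alpha>) *\<^sub>R a)
        + (\<alpha> * row_times k a / (1 - \<alpha>)) *\<^sub>R ((1 - inverse \<alpha>) *\<^sub>R b)"
      using al F(1,2)
      by (simp add: MR s_def matrix_vector_right_distrib matrix_vector_mult_scaleR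
          matrix_vector_mult_add_rdistrib scaleR_left_distrib scaleR_left_diff_distrib scaleR_right_distrib)
    also have "\<dots> = row_times k b *\<^sub>R a - row_times k a *\<^sub>R b"
    proof -
      have "\<alpha> * row_times k a / (1 - \<alpha>) * (1 - inverse \<alpha>) = - row_times k a"
        using al by (simp add: field_simps)
      then show ?thesis using al by simp
    qed
    also have "\<dots> = wedge a b *\<^sub>R vec_of_int (J k)"
      by (simp add: J_def row_times_def wedge_def vec_of_int_def vec_eq_iff forall_2 sum_2 vector_2 algebra_simps)
    finally show ?thesis .
  qed
  have detM: "real_of_int (det M) = real \<theta>"
  proof -
    have "real_of_int (det M) = det (mat_of_int M)" by (simp add: det_2)
    then show ?thesis using F(3) al thR by (simp add: MR)
  qed
  have AM: "mat_of_int A *v (mat_of_int M *v x) = real \<theta> *\<^sub>R x" for x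
    unfolding detM[symmetric]
    by (simp add: A_def det_2 vec_eq_iff forall_2 matrix_vector_mult_def sum_2 vector_2 algebra_simps)
  have ths: "s (int \<theta> *s m) = (wedge b a / real r) *\<^sub>R vec_of_int ((- int r) *s (A *v J m))" for m
  proof -
    have "s (int \<theta> *s m) = real \<theta> *\<^sub>R s m"
      by (simp add: s_def row_times_def sum_2 algebra_simps add_divide_distrib)
    also have "\<dots> = wedge a b *\<^sub>R vec_of_int (A *v J m)"
      by (simp only: AM[symmetric] Ms matrix_vector_mult_scaleR vec_of_int_mult)
    also have "\<dots> = (wedge b a / real r) *\<^sub>R vec_of_int ((- int r) *s (A *v J m))"
    proof -
      have "wedge b a = - wedge a b" by (simp add: wedge_def)
      then show ?thesis using r by (simp only: vec_of_int_scale) simp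
    qed
    finally show ?thesis .
  qed
  have cos: "theta_lattice \<theta> #>\<^bsub>add_group\<^esub> k = {int \<theta> *s m + k |m. True}"
    by (auto simp: theta_lattice_def r_coset_def add_group_def)
  have zero: "int \<theta> *s 0 + k = k" by (simp add: vec_eq_iff)
  have "(\<Union>k\<in>theta_lattice \<theta> #>\<^bsub>add_group\<^esub> k. trans_rep \<alpha> k a b ` c_class r a b c)
     = c_class r a b (trans_rep \<alpha> k a b c)"
  proof (intro equalityI subsetI)
    fix x assume "x \<in> (\<Union>k\<in>theta_lattice \<theta> #>\<^bsub>add_group\<^esub> k. trans_rep \<alpha> k a b ` c_class r a b c)"
    then obtain m n where "x = trans_rep \<alpha> (int \<theta> *s m + k) a b (c + (wedge b a / real r) *\<^sub>R vec_of_int n)"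
      unfolding cos c_class_eq by blast
    also have "\<dots> = trans_rep \<alpha> k a b c
       + (wedge b a / real r) *\<^sub>R vec_of_int (n + (- int r) *s (A *v J m))"
      unfolding tr s_add ths vec_of_int_add by (simp add: scaleR_right_distrib)
    finally show "x \<in> c_class r a b (trans_rep \<alpha> k a b c)" unfolding c_class_eq by blast
  next
    fix x assume "x \<in> c_class r a b (trans_rep \<alpha> k a b c)"
    then obtain n where "x = trans_rep \<alpha> k a b c + (wedge b a / real r) *\<^sub>R vec_of_int n"
      unfolding c_class_eq by blast
    also have "\<dots> = trans_rep \<alpha> k a b (c + (wedge b a / real r) *\<^sub>R vec_of_int n)"
      unfolding tr by simp
    finally have "x \<in> trans_rep \<alpha> k a b ` c_class r a b c" unfolding c_class_eq by blast
    moreover have "k \<in> theta_lattice \<theta> #>\<^bsub>add_group\<^esub> k" unfolding cos using zero by fastforce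
    ultimately show "x \<in> (\<Union>k\<in>theta_lattice \<theta> #>\<^bsub>add_group\<^esub> k. trans_rep \<alpha> k a b ` c_class r a b c)"
      by blast
  qed
  then show ?thesis by (simp add: trans_act_def th_of)
qed

definition Q_class :: "real \<Rightarrow> nat \<Rightarrow> point \<Rightarrow> point set" where
  "Q_class \<alpha> r = orbit (G_group \<alpha>) (G_act_T \<alpha> r)"

definition Q_minus :: "real \<Rightarrow> nat \<Rightarrow> point set set" where
  "Q_minus \<alpha> r = orbits (G_group \<alpha>) (T_quot \<alpha> r) (G_act_T \<alpha> r)"

definition Q_minus_top :: "real \<Rightarrow> nat \<Rightarrow> point set topology" where
  "Q_minus_top \<alpha> r = quotient_topology (T_quot_top \<alpha> r) (Q_class \<alpha> r)"

definition P_class :: "real \<Rightarrow> (real^2) \<times> (real^2) \<Rightarrow> ((real^2) \<times> (real^2)) set" where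
  "P_class \<alpha> = orbit (G_group \<alpha>) (G_act_P \<alpha>)"

definition N_class :: "real \<Rightarrow> int^2^2 \<Rightarrow> (int^2^2) set" where
  "N_class \<alpha> = orbit GL2Z (conj_act \<alpha>)"

text \<open>A map that is equivariant for two group actions sends orbits onto orbits, and the map it
  induces on the orbit spaces sends an orbit to its image.\<close>

definition Phi :: "point set \<Rightarrow> ((real^2) \<times> (real^2)) set" where
  "Phi \<omega> = (\<lambda>(a, b, \<gamma>). (a, b)) ` \<omega>"

definition Psi :: "real \<Rightarrow> point set \<Rightarrow> (int^2^2) set" where
  "Psi \<alpha> \<omega> = (\<lambda>(a, b, \<gamma>). N_of \<alpha> a b) ` \<omega>"

definition Phi_fibre :: "real \<Rightarrow> nat \<Rightarrow> ((real^2) \<times> (real^2)) set \<Rightarrow> point set set" where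
  "Phi_fibre \<alpha> r y = {\<omega> \<in> Q_minus \<alpha> r. Phi \<omega> = y}"

definition Psi_fibre :: "real \<Rightarrow> nat \<Rightarrow> (int^2^2) set \<Rightarrow> point set set" where
  "Psi_fibre \<alpha> r y = {\<omega> \<in> Q_minus \<alpha> r. Psi \<alpha> \<omega> = y}"

definition G_stab :: "real \<Rightarrow> real^2 \<Rightarrow> real^2 \<Rightarrow> G_elt monoid" where
  "G_stab \<alpha> a b =
     (G_group \<alpha>)\<lparr>carrier := stabilizer (G_group \<alpha>) (G_act_P \<alpha>) (a, b)\<rparr>"

definition G_stab_act ::
    "real \<Rightarrow> nat \<Rightarrow> real^2 \<Rightarrow> real^2 \<Rightarrow> G_elt \<Rightarrow> (real^2) set \<Rightarrow> (real^2) set" where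
  "G_stab_act \<alpha> r a b g = (\<lambda>\<gamma>\<in>C_quot \<alpha> r a b. snd (snd (G_act_T \<alpha> r g (a, b, \<gamma>))))"

definition NR_lattice :: "int^2^2 \<Rightarrow> nat \<Rightarrow> (int^2) set" where
  "NR_lattice N r = {(mat 1 + N) *v x + int r *s y |x y. True}"

definition Z_NR :: "int^2^2 \<Rightarrow> nat \<Rightarrow> (int^2) set monoid" where
  "Z_NR N r = add_group Mod NR_lattice N r"

definition Z_NR_class :: "int^2^2 \<Rightarrow> nat \<Rightarrow> int^2 \<Rightarrow> (int^2) set" where
  "Z_NR_class N r p = NR_lattice N r #>\<^bsub>add_group\<^esub> p"

text \<open>The positive centralizer of \<open>N\<close>; the argument \<open>a\<close> is an eigenvector of \<open>N\<close> for the
  eigenvalue $\alpha$, and the group depends on it only through the line it spans.\<close>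

definition pos_centralizer :: "int^2^2 \<Rightarrow> real^2 \<Rightarrow> (int^2^2) monoid" where
  "pos_centralizer N a =
     GL2Z\<lparr>carrier := {K \<in> carrier GL2Z. K ** N = N ** K \<and> (\<exists>t>0. mat_of_int K *v a = t *\<^sub>R a)}\<rparr>"

definition Z_NR_act :: "int^2^2 \<Rightarrow> nat \<Rightarrow> int^2^2 \<Rightarrow> (int^2) set \<Rightarrow> (int^2) set" where
  "Z_NR_act N r K = (\<lambda>\<pi>\<in>carrier (Z_NR N r). (\<lambda>p. det K *s (K *v p)) ` \<pi>)"

end

theory Submission
  imports Defs
begin

text \<open>For fixed $(a,b)$ the matrix $I_2+N$ is invertible over the reals, so \<open>c\<close> and \<open>p\<close> determine
  each other. In terms of \<open>p\<close>, the lattice \<open>c_lattice\<close> acts by translations in $(I_2+N)\mathbb{Z}^2$,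
  the group $\mathbb{Z}^2$ by translations in $r\mathbb{Z}^2$, scalings act trivially, and
  $K\in\mathrm{GL}(2,\mathbb{Z})$ acts as $\varepsilon_KK$ modulo $r\mathbb{Z}^2$. The pair $(a,b)$ is
  determined by \<open>N\<close> up to scaling, so \<open>K\<close> occurs in the stabiliser of $(a,b)$ exactly when it lies in
  the positive centraliser, and pairs with conjugate matrices are equivalent. The orbit map is constant
  where \<open>N\<close> and \<open>p\<close> are constant and \<open>a\<close> stays in a half-plane, so the orbit space is discrete.\<close>

section \<open>Compatible pairs as eigenvector pairs\<close>

text \<open>The factor \<open>det K\<close> comes from the normalisation of \<open>p\<close> by
  \<open>wedge a b / r\<close>: passing from \<open>(a, b)\<close> to \<open>(Ka, Kb)\<close>
  multiplies this unit by \<open>det K\<close>, whose square is 1. The obstacle is the half-integral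
  terms built from \<open>comp_mult\<close> and \<open>row_prods\<close>. They match up only to
  integer multiples of \<open>wedge a b\<close>, and measured in the unit
  \<open>wedge a b / r\<close> such a multiple lies in r Z^2. For the same reason
  \<open>GL_rep\<close> composes only up to a vector of the lattice, so there is an action on
  classes but not on representatives, and the composition laws carry an unspecified integer vector
  \<open>m\<close>. The translation attached to \<open>k\<close> is the inverse of I + N applied to
  \<open>wedge a b\<close> times \<open>k\<close> turned by a right angle; turning permutes Z^2, so
  all of r Z^2 is reached. The positivity in the centraliser reflects the asymmetry \<mu> > 0,
  \<rho> \<noteq> 0: an element fixing \<open>(a, b)\<close> has Ka = a / \<mu>, whereas Kb may be a
  multiple of \<open>b\<close> of either sign. Both bijections are obtained by comparing two
  surjections from \<open>C_set\<close> with the same fibres.\<close>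

lemma mat_of_int_mult: "mat_of_int (A ** B) = mat_of_int A ** mat_of_int B"
  by (simp add: vec_eq_iff matrix_matrix_mult_def)

lemma mat_of_int_one: "mat_of_int (mat 1) = mat 1"
  by (simp add: vec_eq_iff mat_def)

lemma mat_of_int_inject: "mat_of_int A = mat_of_int B \<longleftrightarrow> A = B"
  by (simp add: vec_eq_iff)

lemma vec_of_int_inject: "vec_of_int m = vec_of_int n \<longleftrightarrow> m = n"
  by (simp add: vec_of_int_def vec_eq_iff)

lemma invertible_int_inverses:
  fixes K :: "int^2^2"
  assumes "invertible K"
  shows "K ** matrix_inv K = mat 1" "matrix_inv K ** K = mat 1" "invertible (matrix_inv K)"
proof -
  have *: "K ** matrix_inv K = mat 1 \<and> matrix_inv K ** K = mat 1"
    using assms unfolding invertible_def matrix_inv_def by (rule someI_ex)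
  then show "K ** matrix_inv K = mat 1" "matrix_inv K ** K = mat 1" by auto
  show "invertible (matrix_inv K)" using * unfolding invertible_def by blast
qed

lemma invertible_int_det:
  fixes K :: "int^2^2"
  assumes "invertible K"
  shows "det K = 1 \<or> det K = -1"
  using invertible_int_inverses(1)[OF assms] by (metis det_I det_mul zmult_eq_1_iff)

lemma invertible_int_mat_of_int_cancel:
  assumes "invertible K"
  shows "mat_of_int (matrix_inv K) *v (mat_of_int K *v x) = x"
    and "mat_of_int K *v (mat_of_int (matrix_inv K) *v x) = x"
  using invertible_int_inverses[OF assms]
  by (simp_all add: matrix_vector_mul_assoc flip: mat_of_int_mult) (simp_all add: mat_of_int_one)

lemma wedge_swap: "wedge b a = - wedge a b"
  by (simp add: wedge_def)

lemma independent_pair_iff_wedge: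
  fixes a b :: "real^2"
  shows "a \<noteq> b \<and> independent {a, b} \<longleftrightarrow> wedge a b \<noteq> 0"
proof
  assume "a \<noteq> b \<and> independent {a, b}"
  then show "wedge a b \<noteq> 0" using N_real_facts(4)[of a b 1] by simp
next
  assume w: "wedge a b \<noteq> 0"
  then have b: "b \<noteq> 0" and ab: "a \<noteq> b" by (auto simp: wedge_def)
  have "a \<notin> span {b}"
    using w by (auto simp: span_singleton wedge_def)
  with b ab show "a \<noteq> b \<and> independent {a, b}"
    by (simp add: independent_insert)
qed

lemma eq_on_basis_imp_eq:
  fixes X Y :: "real^2^2"
  assumes w: "wedge a b \<noteq> 0" and "X *v a = Y *v a" "X *v b = Y *v b"
  shows "X = Y"
proof -
  define Z where "Z = X - Y"
  have "Z *v a = 0" "Z *v b = 0"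
    using assms by (simp_all add: Z_def matrix_vector_mult_diff_rdistrib)
  then have e: "Z$i$1 * a$1 + Z$i$2 * a$2 = 0" "Z$i$1 * b$1 + Z$i$2 * b$2 = 0" for i
    by (simp_all add: vec_eq_iff matrix_vector_mult_def sum_2)
  \<comment> \<open>Cramer's rule for the two linear equations satisfied by row \<open>i\<close> of
    \<open>Z\<close>.\<close>
  have "Z$i$1 * wedge a b = (Z$i$1 * a$1 + Z$i$2 * a$2) * b$2 - (Z$i$1 * b$1 + Z$i$2 * b$2) * a$2"
    "Z$i$2 * wedge a b = (Z$i$1 * b$1 + Z$i$2 * b$2) * a$1 - (Z$i$1 * a$1 + Z$i$2 * a$2) * b$1" for i
    by (simp_all add: wedge_def algebra_simps)
  then have "Z$i$1 * wedge a b = 0 \<and> Z$i$2 * wedge a b = 0" for i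
    by (simp only: e mult_zero_left diff_self simp_thms)
  then have "Z$i$1 = 0 \<and> Z$i$2 = 0" for i using w by simp
  then have "Z = 0" by (simp add: vec_eq_iff forall_2)
  then show ?thesis by (simp add: Z_def)
qed

text \<open>Cramer's rule; multiplied by \<open>wedge a b\<close> it is a polynomial identity in the
  coordinates.\<close>

lemma expand_in_basis:
  assumes "wedge a b \<noteq> 0"
  shows "x = (wedge x b / wedge a b) *\<^sub>R a + (wedge a x / wedge a b) *\<^sub>R b"
proof -
  have "wedge a b *\<^sub>R x = wedge x b *\<^sub>R a + wedge a x *\<^sub>R b"
    by (simp add: wedge_def vec_eq_iff forall_2 algebra_simps)
  then have "(1 / wedge a b) *\<^sub>R (wedge a b *\<^sub>R x) = (1 / wedge a b) *\<^sub>R (wedge x b *\<^sub>R a + wedge a x *\<^sub>R b)"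
    by simp
  then show ?thesis using assms by (simp add: scaleR_add_right)
qed

lemma eigenvectors_of_pair:
  assumes w: "wedge a b \<noteq> 0" and Xa: "X *v a = s *\<^sub>R a" and Xb: "X *v b = t *\<^sub>R b"
    and st: "s \<noteq> t"
  shows "X *v x = s *\<^sub>R x \<Longrightarrow> \<exists>m. x = m *\<^sub>R a"
    and "X *v x = t *\<^sub>R x \<Longrightarrow> \<exists>m. x = m *\<^sub>R b"
proof -
  obtain u v where x: "x = u *\<^sub>R a + v *\<^sub>R b" using expand_in_basis[OF w] by blast
  have Xx: "X *v x = (u * s) *\<^sub>R a + (v * t) *\<^sub>R b"
    by (simp add: x matrix_vector_right_distrib matrix_vector_mult_scaleR Xa Xb)
  have b0: "b \<noteq> 0" and a0: "a \<noteq> 0" using w by (auto simp: wedge_def)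
  show "\<exists>m. x = m *\<^sub>R a" if "X *v x = s *\<^sub>R x"
  proof -
    have "(v * (t - s)) *\<^sub>R b = 0"
      using that unfolding Xx by (simp add: x algebra_simps)
    then have "v = 0" using st b0 by simp
    then show ?thesis using x by auto
  qed
  show "\<exists>m. x = m *\<^sub>R b" if "X *v x = t *\<^sub>R x"
  proof -
    have "(u * (s - t)) *\<^sub>R a = 0"
      using that unfolding Xx by (simp add: x algebra_simps)
    then have "u = 0" using st a0 by simp
    then show ?thesis using x by auto
  qed
qed

text \<open>A matrix is determined by its values on the basis \<open>a\<close>, \<open>b\<close>, so
  from here on the two eigenvector equations replace \<open>Q\<close> and its inverse.\<close>

lemma N_real_eq_iff:
  assumes "wedge a b \<noteq> 0" "\<alpha> \<noteq> 0"
  shows "X = N_real \<alpha> a b \<longleftrightarrow> X *v a = \<alpha> *\<^sub>R a \<and> X *v b = (- inverse \<alpha>) *\<^sub>R b"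
proof -
  have "a \<noteq> b" "independent {a, b}" using assms independent_pair_iff_wedge by blast+
  note F = N_real_facts(1,2)[OF this assms(2)]
  show ?thesis using F eq_on_basis_imp_eq[OF assms(1), of X "N_real \<alpha> a b"] by metis
qed

lemma P_minus_iff:
  assumes "\<alpha> \<noteq> 0"
  shows "(a, b) \<in> P_minus \<alpha> \<longleftrightarrow> wedge a b \<noteq> 0 \<and>
    (\<exists>N. mat_of_int N *v a = \<alpha> *\<^sub>R a \<and> mat_of_int N *v b = (- inverse \<alpha>) *\<^sub>R b)"
  using N_real_eq_iff[OF _ assms, of a b] independent_pair_iff_wedge[of a b]
  by (auto simp: P_minus_def)

lemma P_minus_facts:
  assumes "\<alpha> \<noteq> 0" "(a, b) \<in> P_minus \<alpha>"
  shows "wedge a b \<noteq> 0" "mat_of_int (N_of \<alpha> a b) *v a = \<alpha> *\<^sub>R a"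
    "mat_of_int (N_of \<alpha> a b) *v b = (- inverse \<alpha>) *\<^sub>R b"
  using assms P_minus_iff N_real_eq_iff[of a b \<alpha> "mat_of_int (N_of \<alpha> a b)"] N_of_eq[OF assms(2)] by blast+

text \<open>Identifies a candidate integer matrix with the one picked by the definite description in
  \<open>N_of\<close>: only its effect on \<open>a\<close> and \<open>b\<close> has to be
  checked.\<close>

lemma P_minus_N_ofI:
  assumes "\<alpha> \<noteq> 0" "wedge a b \<noteq> 0"
    and "mat_of_int N *v a = \<alpha> *\<^sub>R a" "mat_of_int N *v b = (- inverse \<alpha>) *\<^sub>R b"
  shows "(a, b) \<in> P_minus \<alpha>" "N_of \<alpha> a b = N"
proof -
  show "(a, b) \<in> P_minus \<alpha>" using assms P_minus_iff by blast
  from N_of_eq[OF this] N_real_eq_iff[OF assms(2,1), of "mat_of_int N"] assms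
  show "N_of \<alpha> a b = N" by (metis mat_of_int_inject)
qed

lemma P_minus_action:
  assumes \<alpha>: "\<alpha> \<noteq> 0" and ab: "(a, b) \<in> P_minus \<alpha>" and K: "invertible K"
    and "\<mu> \<noteq> 0" "\<rho> \<noteq> 0"
  shows "(\<mu> *\<^sub>R (mat_of_int K *v a), \<rho> *\<^sub>R (mat_of_int K *v b)) \<in> P_minus \<alpha>"
    and "N_of \<alpha> (\<mu> *\<^sub>R (mat_of_int K *v a)) (\<rho> *\<^sub>R (mat_of_int K *v b))
       = K ** N_of \<alpha> a b ** matrix_inv K"
proof -
  note F = P_minus_facts[OF \<alpha> ab]
  have w: "wedge (\<mu> *\<^sub>R (mat_of_int K *v a)) (\<rho> *\<^sub>R (mat_of_int K *v b)) \<noteq> 0"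
    using F(1) assms(4,5) invertible_int_det[OF K] by (auto simp: wedge_scaleR wedge_mult)
  \<comment> \<open>Stated for any eigenvector, so that it serves for \<open>a\<close> and for
    \<open>b\<close>.\<close>
  have e: "mat_of_int (K ** N_of \<alpha> a b ** matrix_inv K) *v (t *\<^sub>R (mat_of_int K *v x)) =
      s *\<^sub>R (t *\<^sub>R (mat_of_int K *v x))"
    if "mat_of_int (N_of \<alpha> a b) *v x = s *\<^sub>R x" for x s t
    using that invertible_int_mat_of_int_cancel[OF K]
    by (simp add: mat_of_int_mult matrix_vector_mult_scaleR flip: matrix_vector_mul_assoc)
  show "(\<mu> *\<^sub>R (mat_of_int K *v a), \<rho> *\<^sub>R (mat_of_int K *v b)) \<in> P_minus \<alpha>"
    and "N_of \<alpha> (\<mu> *\<^sub>R (mat_of_int K *v a)) (\<rho> *\<^sub>R (mat_of_int K *v b))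
       = K ** N_of \<alpha> a b ** matrix_inv K"
    using P_minus_N_ofI[OF \<alpha> w e e] F by blast+
qed

lemma P_minus_scale:
  assumes "\<alpha> \<noteq> 0" "(a, b) \<in> P_minus \<alpha>" "\<mu> \<noteq> 0" "\<rho> \<noteq> 0"
  shows "(\<mu> *\<^sub>R a, \<rho> *\<^sub>R b) \<in> P_minus \<alpha>"
    and "N_of \<alpha> (\<mu> *\<^sub>R a) (\<rho> *\<^sub>R b) = N_of \<alpha> a b"
proof -
  note F = P_minus_facts[OF assms(1,2)]
  have w: "wedge (\<mu> *\<^sub>R a) (\<rho> *\<^sub>R b) \<noteq> 0" using F(1) assms(3,4) by (simp add: wedge_scaleR)
  have e: "mat_of_int (N_of \<alpha> a b) *v (t *\<^sub>R x) = s *\<^sub>R (t *\<^sub>R x)"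
    if "mat_of_int (N_of \<alpha> a b) *v x = s *\<^sub>R x" for x s t
    using that by (simp add: matrix_vector_mult_scaleR)
  show "(\<mu> *\<^sub>R a, \<rho> *\<^sub>R b) \<in> P_minus \<alpha>" "N_of \<alpha> (\<mu> *\<^sub>R a) (\<rho> *\<^sub>R b) = N_of \<alpha> a b"
    using P_minus_N_ofI[OF assms(1) w e e] F by blast+
qed

text \<open>The two eigenvalues of \<open>N\<close> are distinct, so \<open>N\<close> determines both eigenlines.\<close>

lemma P_minus_same_N:
  assumes "\<alpha> > 0" "(a, b) \<in> P_minus \<alpha>" "(a', b') \<in> P_minus \<alpha>" "N_of \<alpha> a' b' = N_of \<alpha> a b"
  obtains \<mu> \<rho> where "\<mu> \<noteq> 0" "\<rho> \<noteq> 0" "a' = \<mu> *\<^sub>R a" "b' = \<rho> *\<^sub>R b"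
proof -
  have \<alpha>: "\<alpha> \<noteq> 0" using assms(1) by simp
  note F = P_minus_facts[OF \<alpha> assms(2)] and F' = P_minus_facts[OF \<alpha> assms(3)]
  have "\<alpha> \<noteq> - inverse \<alpha>" using assms(1) by (smt (verit) positive_imp_inverse_positive)
  note E = eigenvectors_of_pair[OF F this]
  obtain \<mu> \<rho> where e: "a' = \<mu> *\<^sub>R a" "b' = \<rho> *\<^sub>R b" using E F' assms(4) by metis
  with F'(1) have "\<mu> \<noteq> 0" "\<rho> \<noteq> 0" by (auto simp: wedge_def)
  with e that show ?thesis by blast
qed

text \<open>Conjugation by a commuting \<open>K\<close> fixes the matrix, so \<open>(Ka, Kb)\<close>
  is a compatible pair with the same matrix as \<open>(a, b)\<close> and hence a rescaling of
  it.\<close>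

lemma commuting_eigenvectors:
  assumes "\<alpha> > 0" "(a, b) \<in> P_minus \<alpha>" "invertible K" "K ** N_of \<alpha> a b = N_of \<alpha> a b ** K"
  obtains \<mu> \<rho> where "\<mu> \<noteq> 0" "\<rho> \<noteq> 0" "mat_of_int K *v a = \<mu> *\<^sub>R a" "mat_of_int K *v b = \<rho> *\<^sub>R b"
proof -
  have "K ** N_of \<alpha> a b ** matrix_inv K = N_of \<alpha> a b"
    using assms(4) invertible_int_inverses[OF assms(3)] by (metis matrix_mul_assoc matrix_mul_rid)
  then show ?thesis
    using P_minus_action[of \<alpha> a b K 1 1] P_minus_same_N[OF assms(1,2)] assms that by auto
qed

text \<open>The eigenvalues \<alpha> and -1/\<alpha> have product -1; the determinant is read off
  from the effect of the matrix on \<open>wedge a b\<close>.\<close>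

lemma N_of_in_N_minus:
  assumes "\<alpha> > 0" "(a, b) \<in> P_minus \<alpha>"
  shows "N_of \<alpha> a b \<in> N_minus \<alpha>"
proof -
  have \<alpha>: "\<alpha> \<noteq> 0" using assms(1) by simp
  note F = P_minus_facts[OF \<alpha> assms(2)]
  let ?N = "N_of \<alpha> a b"
  have "of_int (det ?N) * wedge a b = - wedge a b"
    using \<alpha> wedge_mult[of ?N a b] unfolding F by (simp only: wedge_scaleR) (simp add: field_simps)
  then have "real_of_int (det ?N) = -1" using F(1)
    by (metis mult_cancel_right mult_minus1)
  then have d: "det ?N = -1" by linarith
  \<comment> \<open>The negative of the adjugate, which is the integer inverse because the
    determinant is -1.\<close>
  define L :: "int^2^2" where
    "L = vector [vector [- ?N$2$2, ?N$1$2], vector [?N$2$1, - ?N$1$1]]"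
  have "?N ** L = mat 1" "L ** ?N = mat 1"
    using d by (auto simp: L_def det_2 vec_eq_iff forall_2 matrix_matrix_mult_def sum_2 mat_def algebra_simps)
  then have "invertible ?N" unfolding invertible_def by blast
  moreover have "a \<noteq> 0" using F(1) by (auto simp: wedge_def)
  ultimately show ?thesis using d F(2) by (auto simp: N_minus_def)
qed

section \<open>The equation relating $c$ and $p$\<close>

text \<open>Rotation by a right angle. It enters through the identity (kb) a - (ka) b = (a wedge b)
  rot(k), where ka and kb are the products of the row \<open>k\<close> with \<open>a\<close> and
  \<open>b\<close>.\<close>

definition rot :: "int^2 \<Rightarrow> int^2" where
  "rot k = vector [k$2, - k$1]"

lemma rot_onto: "rot (vector [- k$2, k$1]) = k"
  by (simp add: rot_def vec_eq_iff forall_2)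

text \<open>Modulo 2 the products \<open>row_prods\<close> form a crossed homomorphism. Comparing its values on the two
  sides of $KN=N'K$ shows that the half-integral terms in the action of \<open>K\<close> on the equation for \<open>c\<close>
  add up to an integral vector.\<close>

lemma row_prods_mult:
  "\<exists>m. row_prods (K ** L) = K *v row_prods L + det L *s row_prods K + 2 *s m"
proof -
  have even: "2 dvd x * (x - 1)" for x :: int by simp
  \<comment> \<open>Half of the discrepancy in row \<open>i\<close>: replacing the square of an
    entry x of \<open>K\<close> by x costs x(x - 1), which is even, and replacing the permanent of
    \<open>L\<close> by its determinant costs twice \<open>L$1$2 * L$2$1\<close>.\<close>
  define m :: "int^2" where "m = (\<chi> i. (K$i$1 * (K$i$1 - 1) div 2) * (L$1$1 * L$1$2)
     + (K$i$2 * (K$i$2 - 1) div 2) * (L$2$1 * L$2$2) + K$i$1 * K$i$2 * L$1$2 * L$2$1)"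
  have h: "2 * (x * (x - 1) div 2) = x * (x - 1)" for x :: int
    using even by simp
  have "2 * m$i = K$i$1 * (K$i$1 - 1) * (L$1$1 * L$1$2)
     + K$i$2 * (K$i$2 - 1) * (L$2$1 * L$2$2) + 2 * (K$i$1 * K$i$2 * L$1$2 * L$2$1)" for i
    unfolding m_def vec_lambda_beta distrib_left mult.assoc[of "_ div 2" , symmetric]
    using h[of "K$i$1"] h[of "K$i$2"] by (metis (no_types, lifting) mult.assoc)
  then have "row_prods (K ** L) = K *v row_prods L + det L *s row_prods K + 2 *s m"
    by (simp add: vec_eq_iff row_prods_def matrix_matrix_mult_def matrix_vector_mult_def
        sum_2 det_2 algebra_simps)
  then show ?thesis by blast
qed

text \<open>The eigenvalues 1 + \<alpha> and 1 - 1/\<alpha> are nonzero because \<alpha> >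
  1.\<close>

lemma one_plus_N_invertible:
  assumes "\<alpha> > 1" "(a, b) \<in> P_minus \<alpha>"
  shows "invertible (mat 1 + mat_of_int (N_of \<alpha> a b))"
proof -
  have ind: "a \<noteq> b" "independent {a, b}" using assms(2) by (auto simp: P_minus_def)
  have "det (mat 1 + mat_of_int (N_of \<alpha> a b)) = \<alpha> - 1 / \<alpha>"
    using N_real_facts(3)[OF ind, of \<alpha>] assms by (simp add: N_of_eq)
  moreover have "1 / \<alpha> < 1" using assms(1) by simp
  ultimately have "det (mat 1 + mat_of_int (N_of \<alpha> a b)) \<noteq> 0" using assms(1) by linarith
  then show ?thesis by (simp add: invertible_det_nz)
qed

section \<open>Existence and uniqueness of c and p\<close>

lemma c_equation_c_unique:
  assumes "\<alpha> > 1" "(a, b) \<in> P_minus \<alpha>" "c_equation \<alpha> r a b c p" "c_equation \<alpha> r a b c' p"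
  shows "c' = c"
proof -
  let ?M = "mat 1 + mat_of_int (N_of \<alpha> a b)"
  have "?M *v (c - (1/2) *\<^sub>R comp_mult a b) = ?M *v (c' - (1/2) *\<^sub>R comp_mult a b)"
    using assms(3,4) unfolding c_equation_def by (metis diff_add_cancel)
  moreover have "inj ((*v) ?M)"
    using one_plus_N_invertible[OF assms(1,2)] by (metis invertible_def matrix_left_invertible_injective)
  ultimately show ?thesis by (auto dest: injD)
qed

text \<open>I + N is invertible over the reals, so any right-hand side can be reached; this is why
  every integer vector occurs as a value of \<open>p\<close>.\<close>

lemma c_equation_ex:
  assumes "\<alpha> > 1" "(a, b) \<in> P_minus \<alpha>"
  shows "\<exists>c. c_equation \<alpha> r a b c p"
proof -
  let ?M = "mat 1 + mat_of_int (N_of \<alpha> a b)"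
  let ?y = "(wedge a b / real r) *\<^sub>R vec_of_int p + (wedge a b / 2) *\<^sub>R vec_of_int (row_prods (N_of \<alpha> a b))"
  obtain x where "?M *v x = ?y"
    using one_plus_N_invertible[OF assms] unfolding invertible_def
    by (metis matrix_vector_mul_assoc matrix_vector_mul_lid)
  then have "c_equation \<alpha> r a b (x + (1/2) *\<^sub>R comp_mult a b) p"
    by (simp add: c_equation_def)
  then show ?thesis by blast
qed

lemma c_equation_p_unique:
  assumes "wedge a b \<noteq> 0" "r \<ge> 1" "c_equation \<alpha> r a b c p" "c_equation \<alpha> r a b c p'"
  shows "p' = p"
proof -
  have "(wedge a b / real r) *\<^sub>R vec_of_int p = (wedge a b / real r) *\<^sub>R vec_of_int p'"
    using assms(3,4) unfolding c_equation_def by metis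
  then show ?thesis using assms(1,2) by (simp add: vec_of_int_inject)
qed

lemma p_of_eq:
  assumes "wedge a b \<noteq> 0" "r \<ge> 1" "c_equation \<alpha> r a b c p"
  shows "p_of \<alpha> r a b c = p"
  unfolding p_of_def using c_equation_p_unique[OF assms(1,2)] assms(3) by blast

section \<open>Effect of each action on p\<close>

text \<open>The minus sign arises because the lattice is scaled by \<open>wedge b a\<close>, while
  \<open>p\<close> is measured against \<open>wedge a b\<close>.\<close>

lemma c_equation_lattice:
  assumes "c_equation \<alpha> r a b c p"
  shows "c_equation \<alpha> r a b (c + (wedge b a / real r) *\<^sub>R vec_of_int m) (p - (mat 1 + N_of \<alpha> a b) *v m)"
proof -
  let ?M = "mat 1 + mat_of_int (N_of \<alpha> a b)"
  have M: "?M *v vec_of_int m = vec_of_int ((mat 1 + N_of \<alpha> a b) *v m)"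
    by (simp add: matrix_vector_mult_add_rdistrib vec_of_int_add vec_of_int_mult)
  have "?M *v (c + (wedge b a / real r) *\<^sub>R vec_of_int m - (1/2) *\<^sub>R comp_mult a b)
    = ?M *v (c - (1/2) *\<^sub>R comp_mult a b) + (wedge b a / real r) *\<^sub>R (?M *v vec_of_int m)"
    by (simp only: diff_add_eq[symmetric] matrix_vector_right_distrib matrix_vector_mult_scaleR)
  moreover have "vec_of_int (p - (mat 1 + N_of \<alpha> a b) *v m)
      = vec_of_int p - vec_of_int ((mat 1 + N_of \<alpha> a b) *v m)"
    by (simp add: vec_of_int_def vec_eq_iff)
  ultimately show ?thesis
    using assms unfolding c_equation_def M
    by (simp add: wedge_swap[of b a] scaleR_diff_right)
qed

text \<open>The coefficients 1/(1 + \<alpha>) and \<alpha>/(1 - \<alpha>) are, up to sign, the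
  inverses of the eigenvalues of I + N on \<open>a\<close> and \<open>b\<close>. Applying I + N
  therefore leaves (kb) a - (ka) b, that is \<open>wedge a b\<close> times \<open>rot k\<close>, and
  the denominator \<open>r\<close> turns this into the shift by
  \<open>int r *s rot k\<close>.\<close>

lemma c_equation_trans:
  assumes "\<alpha> > 1" "(a, b) \<in> P_minus \<alpha>" "r \<ge> 1" "c_equation \<alpha> r a b c p"
  shows "c_equation \<alpha> r a b (trans_rep \<alpha> k a b c) (p + int r *s rot k)"
proof -
  have \<alpha>: "\<alpha> \<noteq> 0" using assms(1) by simp
  note F = P_minus_facts[OF \<alpha> assms(2)]
  let ?M = "mat 1 + mat_of_int (N_of \<alpha> a b)"
  let ?s = "(row_times k b / (1 + \<alpha>)) *\<^sub>R a + (\<alpha> * row_times k a / (1 - \<alpha>)) *\<^sub>R b"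
  have Ma: "?M *v a = (1 + \<alpha>) *\<^sub>R a" and Mb: "?M *v b = (1 - inverse \<alpha>) *\<^sub>R b"
    by (simp_all add: F matrix_vector_mult_add_rdistrib scaleR_left_distrib scaleR_left_diff_distrib)
  have "?M *v ?s = (row_times k b / (1 + \<alpha>) * (1 + \<alpha>)) *\<^sub>R a
       + (\<alpha> * row_times k a / (1 - \<alpha>) * (1 - inverse \<alpha>)) *\<^sub>R b"
    by (simp only: Ma Mb matrix_vector_right_distrib matrix_vector_mult_scaleR scaleR_scaleR)
  also have "row_times k b / (1 + \<alpha>) * (1 + \<alpha>) = row_times k b"
    using assms(1) by simp
  also have "\<alpha> * row_times k a / (1 - \<alpha>) * (1 - inverse \<alpha>) = - row_times k a"
    using assms(1) by (simp add: field_simps)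
  also have "row_times k b *\<^sub>R a + (- row_times k a) *\<^sub>R b = wedge a b *\<^sub>R vec_of_int (rot k)"
    by (simp add: rot_def row_times_def wedge_def vec_of_int_def vec_eq_iff forall_2 sum_2 algebra_simps)
  finally have Ms: "?M *v ?s = (wedge a b / real r) *\<^sub>R vec_of_int (int r *s rot k)"
    using assms(3) by (simp add: vec_of_int_scale)
  have "trans_rep \<alpha> k a b c - (1/2) *\<^sub>R comp_mult a b = (c - (1/2) *\<^sub>R comp_mult a b) + ?s"
    by (simp add: trans_rep_def)
  then have "?M *v (trans_rep \<alpha> k a b c - (1/2) *\<^sub>R comp_mult a b)
      = ?M *v (c - (1/2) *\<^sub>R comp_mult a b) + ?M *v ?s"
    by (simp only: matrix_vector_right_distrib)
  then show ?thesis
    using assms(4) unfolding c_equation_def Ms vec_of_int_add by (simp add: scaleR_add_right)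
qed

lemma comp_mult_scaleR: "comp_mult (\<mu> *\<^sub>R a) (\<rho> *\<^sub>R b) = (\<mu> * \<rho>) *\<^sub>R comp_mult a b"
  by (simp add: comp_mult_def vec_eq_iff)

text \<open>Every term of the equation is multiplied by \<mu>\<rho> while the matrix stays the same,
  so the factor cancels.\<close>

lemma c_equation_scale:
  assumes "\<alpha> > 1" "(a, b) \<in> P_minus \<alpha>" "\<mu> \<noteq> 0" "\<rho> \<noteq> 0" "c_equation \<alpha> r a b c p"
  shows "c_equation \<alpha> r (\<mu> *\<^sub>R a) (\<rho> *\<^sub>R b) ((\<mu> * \<rho>) *\<^sub>R c) p"
proof -
  let ?M = "mat 1 + mat_of_int (N_of \<alpha> a b)"
  have \<alpha>: "\<alpha> \<noteq> 0" using assms(1) by simp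
  have 1: "(\<mu> * \<rho>) *\<^sub>R c - (1/2) *\<^sub>R comp_mult (\<mu> *\<^sub>R a) (\<rho> *\<^sub>R b)
      = (\<mu> * \<rho>) *\<^sub>R (c - (1/2) *\<^sub>R comp_mult a b)"
    by (simp add: comp_mult_scaleR scaleR_diff_right)
  have "?M *v ((\<mu> * \<rho>) *\<^sub>R (c - (1/2) *\<^sub>R comp_mult a b))
       - (\<mu> * \<rho> * wedge a b / 2) *\<^sub>R vec_of_int (row_prods (N_of \<alpha> a b))
     = (\<mu> * \<rho>) *\<^sub>R (?M *v (c - (1/2) *\<^sub>R comp_mult a b)
       - (wedge a b / 2) *\<^sub>R vec_of_int (row_prods (N_of \<alpha> a b)))"
    unfolding matrix_vector_mult_scaleR[of ?M "\<mu> * \<rho>"] scaleR_diff_right[of "\<mu> * \<rho>" "?M *v _"] by simp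
  also have "\<dots> = (\<mu> * \<rho>) *\<^sub>R ((wedge a b / real r) *\<^sub>R vec_of_int p)"
    using assms(5) by (simp only: c_equation_def)
  finally show ?thesis
    unfolding c_equation_def P_minus_scale(2)[OF \<alpha> assms(2-4)] wedge_scaleR 1 by simp
qed

text \<open>Applying \<open>K\<close> to the equation and using N'K = K(N) produces the equation of
  the new pair. The new wedge is \<open>det K\<close> times the old one, which gives the sign; the
  half-integral terms leave an integer multiple of the wedge, absorbed in \<open>m\<close>.\<close>

lemma c_equation_GL:
  assumes "\<alpha> > 1" "(a, b) \<in> P_minus \<alpha>" "r \<ge> 1" "invertible K" "c_equation \<alpha> r a b c p"
  shows "\<exists>m. c_equation \<alpha> r (mat_of_int K *v a) (mat_of_int K *v b) (GL_rep K a b c)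
    (det K *s (K *v p) + int r *s m)"
proof -
  have \<alpha>: "\<alpha> \<noteq> 0" "\<alpha> > 0" using assms(1) by auto
  define N N' d w where "N = N_of \<alpha> a b" and "N' = K ** N ** matrix_inv K"
    and "d = det K" and "w = wedge a b"
  let ?k = "mat_of_int K"
  let ?M = "mat 1 + mat_of_int N" and ?M' = "mat 1 + mat_of_int N'"
  let ?x = "c - (1/2) *\<^sub>R comp_mult a b"
  have N': "N_of \<alpha> (?k *v a) (?k *v b) = N'"
    using P_minus_action(2)[OF \<alpha>(1) assms(2,4), of 1 1] by (simp add: N_def N'_def)
  have dN: "det N = -1" using N_of_in_N_minus[OF \<alpha>(2) assms(2)] by (simp add: N_def N_minus_def)
  have comm: "N' ** K = K ** N"
    using invertible_int_inverses[OF assms(4)] by (simp add: N'_def flip: matrix_mul_assoc)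
  have dd: "real_of_int d * real_of_int d = 1"
    using invertible_int_det[OF assms(4)] by (auto simp: d_def)
  \<comment> \<open>\<open>K ** N\<close> and \<open>N' ** K\<close> are the same matrix; its row
    products are expanded in both ways.\<close>
  obtain m1 where m1: "row_prods (K ** N) = K *v row_prods N + det N *s row_prods K + 2 *s m1"
    using row_prods_mult by blast
  obtain m2 where m2: "row_prods (N' ** K) = N' *v row_prods K + d *s row_prods N' + 2 *s m2"
    using row_prods_mult d_def by blast
  \<comment> \<open>As \<open>det N = -1\<close>, equating the expansions puts
    \<open>row_prods K\<close> next to \<open>N' *v row_prods K\<close>. Together they form I + N'
    applied to \<open>row_prods K\<close>, which is cancelled by the correction term in
    \<open>GL_rep\<close>.\<close>
  have "K *v row_prods N = row_prods K + N' *v row_prods K + d *s row_prods N' + 2 *s (m2 - m1)"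
    using m1 m2 unfolding comm dN by (simp add: vec_eq_iff algebra_simps)
  from arg_cong[OF this, of vec_of_int]
  have rp: "?k *v vec_of_int (row_prods N) = ?M' *v vec_of_int (row_prods K)
      + of_int d *\<^sub>R vec_of_int (row_prods N') + 2 *\<^sub>R vec_of_int (m2 - m1)"
    by (simp only: vec_of_int_add vec_of_int_mult vec_of_int_scale matrix_vector_mult_add_rdistrib)
       (simp add: algebra_simps)
  have "mat_of_int N' *v (?k *v x) = ?k *v (mat_of_int N *v x)" for x
    using comm by (metis mat_of_int_mult matrix_vector_mul_assoc)
  then have MK: "?M' *v (?k *v x) = ?k *v (?M *v x)" for x
    by (simp add: matrix_vector_mult_add_rdistrib matrix_vector_right_distrib)
  have Mx: "?M *v ?x = (w / 2) *\<^sub>R vec_of_int (row_prods N) + (w / real r) *\<^sub>R vec_of_int p"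
    using assms(5) by (simp add: c_equation_def N_def w_def algebra_simps)
  have "?M' *v (GL_rep K a b c - (1/2) *\<^sub>R comp_mult (?k *v a) (?k *v b))
      = ?M' *v (?k *v ?x) + ?M' *v (- (w/2) *\<^sub>R vec_of_int (row_prods K))"
    by (simp add: GL_rep_def wedge_swap[of b a] w_def flip: matrix_vector_right_distrib)
  also have "\<dots> = (w/2) *\<^sub>R (?k *v vec_of_int (row_prods N)) + (w / real r) *\<^sub>R (?k *v vec_of_int p)
       - (w/2) *\<^sub>R (?M' *v vec_of_int (row_prods K))"
    unfolding MK Mx matrix_vector_right_distrib matrix_vector_mult_scaleR by simp
  also have "\<dots> = (of_int d * w / 2) *\<^sub>R vec_of_int (row_prods N')
       + (w *\<^sub>R vec_of_int (m2 - m1) + (w / real r) *\<^sub>R (?k *v vec_of_int p))"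
    unfolding rp by (simp add: algebra_simps)
  also have "w *\<^sub>R vec_of_int (m2 - m1) + (w / real r) *\<^sub>R (?k *v vec_of_int p)
     = (of_int d * w / real r) *\<^sub>R vec_of_int (d *s (K *v p) + int r *s (d *s (m2 - m1)))"
  proof -
    \<comment> \<open>The unit for the new pair is \<open>d * w / r\<close>; since
      \<open>d * d = 1\<close>, the sign moves into the integer vectors, and the multiple of
      \<open>w\<close> acquires the factor \<open>r\<close>.\<close>
    have "(of_int d * w / real r * of_int d) = w / real r"
      "(of_int d * w / real r * (real r * of_int d)) = w"
      using dd assms(3) by (simp_all add: field_simps)
    then show ?thesis
      by (simp only: vec_of_int_add vec_of_int_scale vec_of_int_mult scaleR_add_right scaleR_scaleR
          of_int_of_nat_eq add.commute)
  qed
  finally have "?M' *v (GL_rep K a b c - (1/2) *\<^sub>R comp_mult (?k *v a) (?k *v b))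
       - (of_int d * w / 2) *\<^sub>R vec_of_int (row_prods N')
      = (of_int d * w / real r) *\<^sub>R vec_of_int (d *s (K *v p) + int r *s (d *s (m2 - m1)))"
    by (simp add: add.assoc)
  then show ?thesis
    unfolding c_equation_def N' wedge_mult d_def w_def by blast
qed

section \<open>Composition laws on representatives\<close>

text \<open>The even defect \<open>2 *s m\<close> of the crossed homomorphism
  \<open>row_prods\<close> meets the factor \<open>wedge b a / 2\<close>; the result is an integer
  multiple of \<open>wedge b a\<close>, hence a lattice vector whatever \<open>r\<close> is.\<close>

lemma GL_rep_mult:
  assumes "r \<ge> 1"
  shows "\<exists>m. GL_rep K (mat_of_int L *v a) (mat_of_int L *v b) (GL_rep L a b c)
    = GL_rep (K ** L) a b c + (wedge b a / real r) *\<^sub>R vec_of_int m"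
proof -
  obtain m where m: "row_prods (K ** L) = K *v row_prods L + det L *s row_prods K + 2 *s m"
    using row_prods_mult by blast
  let ?k = "mat_of_int K" and ?l = "mat_of_int L"
  have "GL_rep K (?l *v a) (?l *v b) (GL_rep L a b c)
    = (1/2) *\<^sub>R comp_mult (?k *v (?l *v a)) (?k *v (?l *v b))
      + ?k *v (?l *v (c - (1/2) *\<^sub>R comp_mult a b))
      + (wedge b a / 2) *\<^sub>R (?k *v vec_of_int (row_prods L) + of_int (det L) *\<^sub>R vec_of_int (row_prods K))"
    by (simp add: GL_rep_def wedge_mult matrix_vector_right_distrib matrix_vector_mult_scaleR algebra_simps)
  also have "?k *v vec_of_int (row_prods L) + of_int (det L) *\<^sub>R vec_of_int (row_prods K)
     = vec_of_int (row_prods (K ** L)) + 2 *\<^sub>R vec_of_int (- m)"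
  proof -
    have "vec_of_int (- m) = - vec_of_int m" by (simp add: vec_of_int_def vec_eq_iff)
    then show ?thesis
      unfolding m vec_of_int_add vec_of_int_mult vec_of_int_scale by simp
  qed
  also have "(1/2) *\<^sub>R comp_mult (?k *v (?l *v a)) (?k *v (?l *v b))
      + ?k *v (?l *v (c - (1/2) *\<^sub>R comp_mult a b))
      + (wedge b a / 2) *\<^sub>R (vec_of_int (row_prods (K ** L)) + 2 *\<^sub>R vec_of_int (- m))
     = GL_rep (K ** L) a b c + wedge b a *\<^sub>R vec_of_int (- m)"
    by (simp add: GL_rep_def mat_of_int_mult scaleR_add_right flip: matrix_vector_mul_assoc)
  also have "wedge b a *\<^sub>R vec_of_int (- m) = (wedge b a / real r) *\<^sub>R vec_of_int (int r *s (- m))"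
    unfolding vec_of_int_scale using assms by simp
  finally show ?thesis by blast
qed

lemma row_times_vector_matrix: "row_times (k v* K) x = row_times k (mat_of_int K *v x)"
  by (simp add: row_times_def vector_matrix_mult_def matrix_vector_mult_def sum_2 algebra_simps)

text \<open>Origin of the twist in the semidirect product: k(Ka) = (kK)a, so moving a translation
  past \<open>K\<close> replaces \<open>k\<close> by \<open>k v* K\<close>.\<close>

lemma trans_rep_GL_rep:
  "trans_rep \<alpha> k (mat_of_int K *v a) (mat_of_int K *v b) (GL_rep K a b c)
    = GL_rep K a b (trans_rep \<alpha> (k v* K) a b c)"
  by (simp add: trans_rep_def GL_rep_def row_times_vector_matrix matrix_vector_right_distrib
      matrix_vector_mult_diff_distrib matrix_vector_mult_scaleR)

lemma trans_rep_add: "trans_rep \<alpha> k a b (trans_rep \<alpha> l a b c) = trans_rep \<alpha> (k + l) a b c"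
  by (simp add: trans_rep_def row_times_def sum_2 algebra_simps add_divide_distrib)

lemma trans_rep_scale:
  "trans_rep \<alpha> k (\<mu> *\<^sub>R a) (\<rho> *\<^sub>R b) ((\<mu> * \<rho>) *\<^sub>R c) = (\<mu> * \<rho>) *\<^sub>R trans_rep \<alpha> k a b c"
  by (simp add: trans_rep_def row_times_def sum_2 algebra_simps)

lemma GL_rep_scale:
  "GL_rep K (\<mu> *\<^sub>R a) (\<rho> *\<^sub>R b) ((\<mu> * \<rho>) *\<^sub>R c) = (\<mu> * \<rho>) *\<^sub>R GL_rep K a b c"
  by (simp add: GL_rep_def wedge_scaleR comp_mult_scaleR matrix_vector_mult_scaleR
      matrix_vector_mult_diff_distrib scaleR_add_right scaleR_diff_right)

lemma c_class_self: "c \<in> c_class r a b c"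
proof -
  have "c = c + (wedge b a / real r) *\<^sub>R vec_of_int 0" by (simp add: vec_of_int_def vec_eq_iff)
  then show ?thesis unfolding c_class_eq by blast
qed

lemma c_class_eq_iff:
  "c_class r a b c' = c_class r a b c \<longleftrightarrow> (\<exists>m. c' = c + (wedge b a / real r) *\<^sub>R vec_of_int m)"
proof
  assume "c_class r a b c' = c_class r a b c"
  then show "\<exists>m. c' = c + (wedge b a / real r) *\<^sub>R vec_of_int m"
    using c_class_self[of c' r a b] unfolding c_class_eq by blast
next
  assume "\<exists>m. c' = c + (wedge b a / real r) *\<^sub>R vec_of_int m"
  then obtain m where m: "c' = c + (wedge b a / real r) *\<^sub>R vec_of_int m" by blast
  have minus: "vec_of_int (n - m) = vec_of_int n - vec_of_int m" for n
    by (simp add: vec_of_int_def vec_eq_iff)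
  have "c' + (wedge b a / real r) *\<^sub>R vec_of_int n = c + (wedge b a / real r) *\<^sub>R vec_of_int (m + n)"
    "c + (wedge b a / real r) *\<^sub>R vec_of_int n = c' + (wedge b a / real r) *\<^sub>R vec_of_int (n - m)" for n
    unfolding m vec_of_int_add minus by (simp_all add: algebra_simps)
  then show "c_class r a b c' = c_class r a b c" unfolding c_class_eq by blast
qed

section \<open>The acting groups\<close>

text \<open>An action is a homomorphism into \<open>BijGroup E\<close>, whose elements are
  extensional bijections; bijectivity of each map follows from the map of the inverse
  element.\<close>

lemma group_actionI:
  assumes "group G"
    and closed: "\<And>g x. g \<in> carrier G \<Longrightarrow> x \<in> E \<Longrightarrow> \<phi> g x \<in> E"
    and ext: "\<And>g. g \<in> carrier G \<Longrightarrow> \<phi> g \<in> extensional E"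
    and mult: "\<And>g h x. g \<in> carrier G \<Longrightarrow> h \<in> carrier G \<Longrightarrow> x \<in> E \<Longrightarrow> \<phi> (g \<otimes>\<^bsub>G\<^esub> h) x = \<phi> g (\<phi> h x)"
    and one: "\<And>x. x \<in> E \<Longrightarrow> \<phi> \<one>\<^bsub>G\<^esub> x = x"
  shows "group_action G E \<phi>"
proof -
  interpret G: group G by fact
  have cancel: "\<phi> (inv\<^bsub>G\<^esub> g) (\<phi> g x) = x" "\<phi> g (\<phi> (inv\<^bsub>G\<^esub> g) x) = x"
    if "g \<in> carrier G" "x \<in> E" for g x
    using that mult[of "inv\<^bsub>G\<^esub> g" g x] mult[of g "inv\<^bsub>G\<^esub> g" x] one[of x] by simp_all
  have bij: "\<phi> g \<in> Bij E" if "g \<in> carrier G" for g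
  proof -
    have "bij_betw (\<phi> g) E E"
      by (rule bij_betw_byWitness[where f' = "\<phi> (inv\<^bsub>G\<^esub> g)"]) (use that cancel closed in auto)
    then show ?thesis using ext[OF that] by (simp add: Bij_def)
  qed
  have "\<phi> \<in> hom G (BijGroup E)"
  proof (rule homI)
    show "\<phi> g \<in> carrier (BijGroup E)" if "g \<in> carrier G" for g
      using bij[OF that] by (simp add: BijGroup_def)
  next
    fix g h assume gh: "g \<in> carrier G" "h \<in> carrier G"
    have "\<phi> (g \<otimes>\<^bsub>G\<^esub> h) = compose E (\<phi> g) (\<phi> h)"
      by (rule extensionalityI[OF ext]) (use gh mult in \<open>auto simp: compose_def\<close>)
    then show "\<phi> (g \<otimes>\<^bsub>G\<^esub> h) = \<phi> g \<otimes>\<^bsub>BijGroup E\<^esub> \<phi> h"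
      using bij gh by (simp add: BijGroup_def)
  qed
  then show ?thesis
    by (simp add: group_action_def group_hom_def group_hom_axioms_def group_BijGroup G.is_group)
qed

lemma add_group_comm_group: "comm_group (add_group :: 'a::ab_group_add monoid)"
proof (rule comm_groupI)
  fix x :: 'a
  have "- x \<otimes>\<^bsub>add_group\<^esub> x = \<one>\<^bsub>add_group\<^esub>" "- x \<in> carrier add_group"
    by (simp_all add: add_group_def)
  then show "\<exists>y\<in>carrier add_group. y \<otimes>\<^bsub>add_group\<^esub> x = \<one>\<^bsub>add_group\<^esub>" by blast
qed (simp_all add: add_group_def ac_simps)

lemma add_group_normal:
  fixes H :: "'a::ab_group_add set"
  assumes "0 \<in> H" "\<And>x y. x \<in> H \<Longrightarrow> y \<in> H \<Longrightarrow> x - y \<in> H"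
  shows "H \<lhd> add_group"
proof -
  interpret comm_group "add_group :: 'a monoid" by (rule add_group_comm_group)
  have neg: "- x \<in> H" if "x \<in> H" for x using assms(2)[OF assms(1) that] by simp
  have add: "x + y \<in> H" if "x \<in> H" "y \<in> H" for x y using assms(2)[OF that(1) neg[OF that(2)]] by simp
  have inv: "inv\<^bsub>add_group\<^esub> x = - x" for x :: 'a
    by (rule inv_equality) (simp_all add: add_group_def)
  have "subgroup H add_group"
    by (rule subgroup.intro) (auto simp: inv neg add assms(1), simp_all add: add_group_def add assms(1))
  then show ?thesis by (rule normal_iff_subgroup[THEN iffD2])
qed

lemma add_group_coset: "H #>\<^bsub>add_group\<^esub> k = {h + k |h. h \<in> H}"
  by (auto simp: r_coset_def add_group_def)

lemma add_group_coset_self: "0 \<in> H \<Longrightarrow> k \<in> H #>\<^bsub>add_group\<^esub> k"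
  unfolding add_group_coset by force

lemma add_group_coset_eq_iff:
  assumes "H \<lhd> (add_group :: 'a::ab_group_add monoid)"
  shows "H #>\<^bsub>add_group\<^esub> x = H #>\<^bsub>add_group\<^esub> y \<longleftrightarrow> x - y \<in> H"
proof -
  interpret normal H "add_group :: 'a monoid" by fact
  have z: "0 \<in> H" using subgroup.one_closed[OF subgroup_axioms] by (simp add: add_group_def)
  have "x \<in> H #>\<^bsub>add_group\<^esub> y \<longleftrightarrow> x - y \<in> H"
  proof
    assume "x \<in> H #>\<^bsub>add_group\<^esub> y"
    then show "x - y \<in> H" unfolding add_group_coset by auto
  next
    assume "x - y \<in> H"
    moreover have "x = (x - y) + y" by simp
    ultimately show "x \<in> H #>\<^bsub>add_group\<^esub> y" unfolding add_group_coset by blast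
  qed
  moreover have "x \<in> H #>\<^bsub>add_group\<^esub> y \<Longrightarrow> H #>\<^bsub>add_group\<^esub> y = H #>\<^bsub>add_group\<^esub> x"
    using repr_independence[of x H y] subgroup_axioms by (simp add: add_group_def)
  ultimately show ?thesis using add_group_coset_self[OF z] by metis
qed

section \<open>Translations modulo theta and the semidirect product\<close>

lemma theta_lattice_normal: "theta_lattice \<theta> \<lhd> add_group"
proof (rule add_group_normal)
  have "(0 :: int^2) = int \<theta> *s 0" by (simp add: vec_eq_iff)
  then show "0 \<in> theta_lattice \<theta>" by (auto simp: theta_lattice_def)
next
  fix x y assume "x \<in> theta_lattice \<theta>" "y \<in> theta_lattice \<theta>"
  then obtain m n where "x = int \<theta> *s m" "y = int \<theta> *s n" by (auto simp: theta_lattice_def)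
  then have "x - y = int \<theta> *s (m - n)" by (simp add: vec_eq_iff algebra_simps)
  then show "x - y \<in> theta_lattice \<theta>" unfolding theta_lattice_def by (rule range_eqI)
qed

abbreviation theta_coset :: "nat \<Rightarrow> int^2 \<Rightarrow> (int^2) set" where
  "theta_coset \<theta> k \<equiv> theta_lattice \<theta> #>\<^bsub>add_group\<^esub> k"

lemma theta_coset_0: "theta_coset \<theta> 0 = theta_lattice \<theta>"
  by (simp add: add_group_coset)

lemma Z_theta2_carrier: "carrier (Z_theta2 \<theta>) = range (theta_coset \<theta>)"
  by (auto simp: Z_theta2_def FactGroup_def RCOSETS_def add_group_def)

lemma Z_theta2_one: "\<one>\<^bsub>Z_theta2 \<theta>\<^esub> = theta_coset \<theta> 0"
  by (simp add: Z_theta2_def FactGroup_def theta_coset_0)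

lemma Z_theta2_mult: "theta_coset \<theta> k \<otimes>\<^bsub>Z_theta2 \<theta>\<^esub> theta_coset \<theta> l = theta_coset \<theta> (k + l)"
  using normal.rcos_sum[OF theta_lattice_normal, of k l \<theta>]
  by (simp add: Z_theta2_def FactGroup_def add_group_def)

lemma vector_matrix_mult_assoc:
  fixes k :: "int^2" and K L :: "int^2^2"
  shows "(k v* K) v* L = k v* (K ** L)"
  by (simp add: vec_eq_iff vector_matrix_mult_def matrix_matrix_mult_def sum_2 algebra_simps)

lemma vector_matrix_mult_add:
  fixes k :: "int^2" and K :: "int^2^2"
  shows "(k + l) v* K = k v* K + l v* K"
  by (simp add: vec_eq_iff vector_matrix_mult_def sum_2 algebra_simps)

lemma vector_matrix_mult_scale:
  fixes k :: "int^2" and K :: "int^2^2"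
  shows "(t *s k) v* K = t *s (k v* K)"
  by (simp add: vec_eq_iff vector_matrix_mult_def sum_2 algebra_simps)

lemma vector_matrix_mult_one: "(k :: int^2) v* mat 1 = k"
  by (simp add: vec_eq_iff vector_matrix_mult_def mat_def sum_2 forall_2)

text \<open>Right multiplication by an invertible matrix is onto Z^2 and commutes with scaling, so
  it maps the lattice onto itself. Hence images of cosets, as used in the group law, are full
  cosets.\<close>

lemma theta_coset_image:
  assumes "invertible K"
  shows "(\<lambda>k. k v* K) ` theta_coset \<theta> k = theta_coset \<theta> (k v* K)"
proof -
  have "n = (n v* matrix_inv K) v* K" for n
    by (simp add: vector_matrix_mult_assoc invertible_int_inverses[OF assms] vector_matrix_mult_one)
  then have "range (\<lambda>k. k v* K) = UNIV" by (metis surjI)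
  then have "(\<lambda>k. k v* K) ` theta_lattice \<theta> = theta_lattice \<theta>"
    unfolding theta_lattice_def image_image vector_matrix_mult_scale by (metis image_image)
  moreover have "(\<lambda>k. k v* K) ` theta_coset \<theta> k = {h + k v* K |h. h \<in> (\<lambda>k. k v* K) ` theta_lattice \<theta>}"
    unfolding add_group_coset Setcompr_eq_image image_image by (simp add: vector_matrix_mult_add)
  ultimately show ?thesis by (simp add: add_group_coset)
qed

lemma GL2Z_simps [simp]:
  "K \<in> carrier GL2Z \<longleftrightarrow> invertible K" "K \<otimes>\<^bsub>GL2Z\<^esub> L = K ** L" "\<one>\<^bsub>GL2Z\<^esub> = mat 1"
  by (simp_all add: GL2Z_def)

lemma invertible_int_one: "invertible (mat 1 :: int^2^2)"
  unfolding invertible_def by (metis matrix_mul_lid)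

lemma invertible_int_mult:
  fixes K L :: "int^2^2"
  assumes "invertible K" "invertible L"
  shows "invertible (K ** L)"
proof -
  have "K ** L ** (matrix_inv L ** matrix_inv K) = K ** (L ** matrix_inv L) ** matrix_inv K"
    "matrix_inv L ** matrix_inv K ** (K ** L) = matrix_inv L ** (matrix_inv K ** K) ** L"
    by (simp_all only: matrix_mul_assoc)
  then have "K ** L ** (matrix_inv L ** matrix_inv K) = mat 1" "matrix_inv L ** matrix_inv K ** (K ** L) = mat 1"
    by (simp_all add: invertible_int_inverses assms)
  then show ?thesis unfolding invertible_def by blast
qed

lemma semidirect_mult:
  assumes "invertible L"
  shows "(K, theta_coset \<theta> k) \<otimes>\<^bsub>semidirect_group \<theta>\<^esub> (L, theta_coset \<theta> l)
    = (K ** L, theta_coset \<theta> (k v* L + l))"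
  by (simp add: semidirect_group_def theta_coset_image[OF assms] Z_theta2_mult)

lemma semidirect_carrier:
  "x \<in> carrier (semidirect_group \<theta>) \<longleftrightarrow> (\<exists>K k. x = (K, theta_coset \<theta> k) \<and> invertible K)"
  by (auto simp: semidirect_group_def Z_theta2_carrier)

lemma semidirect_one: "\<one>\<^bsub>semidirect_group \<theta>\<^esub> = (mat 1, theta_coset \<theta> 0)"
  by (simp add: semidirect_group_def Z_theta2_one)

lemma semidirect_group: "group (semidirect_group \<theta>)"
proof (rule groupI)
  show "\<one>\<^bsub>semidirect_group \<theta>\<^esub> \<in> carrier (semidirect_group \<theta>)"
    unfolding semidirect_one semidirect_carrier using invertible_int_one by blast
next
  fix x y assume "x \<in> carrier (semidirect_group \<theta>)" "y \<in> carrier (semidirect_group \<theta>)"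
  then show "x \<otimes>\<^bsub>semidirect_group \<theta>\<^esub> y \<in> carrier (semidirect_group \<theta>)"
    unfolding semidirect_carrier using semidirect_mult invertible_int_mult by metis
next
  fix x y z assume "x \<in> carrier (semidirect_group \<theta>)" "y \<in> carrier (semidirect_group \<theta>)"
    "z \<in> carrier (semidirect_group \<theta>)"
  then show "x \<otimes>\<^bsub>semidirect_group \<theta>\<^esub> y \<otimes>\<^bsub>semidirect_group \<theta>\<^esub> z
    = x \<otimes>\<^bsub>semidirect_group \<theta>\<^esub> (y \<otimes>\<^bsub>semidirect_group \<theta>\<^esub> z)"
    unfolding semidirect_carrier
    by (auto simp: semidirect_mult invertible_int_mult matrix_mul_assoc vector_matrix_mult_add
        vector_matrix_mult_assoc add.assoc)
next
  fix x assume "x \<in> carrier (semidirect_group \<theta>)"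
  then obtain K k where x: "x = (K, theta_coset \<theta> k)" and K: "invertible K"
    unfolding semidirect_carrier by blast
  have z: "(0 :: int^2) v* K = 0" by (simp add: vec_eq_iff vector_matrix_mult_def)
  show "\<one>\<^bsub>semidirect_group \<theta>\<^esub> \<otimes>\<^bsub>semidirect_group \<theta>\<^esub> x = x"
    by (simp add: semidirect_one x semidirect_mult[OF K] z)
  \<comment> \<open>The translation part \<open>l\<close> solves
    \<open>l v* K + k = 0\<close>.\<close>
  let ?y = "(matrix_inv K, theta_coset \<theta> ((- k) v* matrix_inv K))"
  have "?y \<otimes>\<^bsub>semidirect_group \<theta>\<^esub> x = \<one>\<^bsub>semidirect_group \<theta>\<^esub>"
    by (simp add: semidirect_one x semidirect_mult[OF K] vector_matrix_mult_assoc
        invertible_int_inverses[OF K] vector_matrix_mult_one)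
  moreover have "?y \<in> carrier (semidirect_group \<theta>)"
    unfolding semidirect_carrier using invertible_int_inverses(3)[OF K] by blast
  ultimately show "\<exists>y\<in>carrier (semidirect_group \<theta>). y \<otimes>\<^bsub>semidirect_group \<theta>\<^esub> x = \<one>\<^bsub>semidirect_group \<theta>\<^esub>"
    by blast
qed

lemma G_group_group: "group (G_group \<alpha>)"
proof -
  have "group pos_reals_group"
  proof (rule groupI)
    fix x assume "x \<in> carrier pos_reals_group"
    then have "inverse x \<in> carrier pos_reals_group" "inverse x \<otimes>\<^bsub>pos_reals_group\<^esub> x = \<one>\<^bsub>pos_reals_group\<^esub>"
      by (simp_all add: pos_reals_group_def)
    then show "\<exists>y\<in>carrier pos_reals_group. y \<otimes>\<^bsub>pos_reals_group\<^esub> x = \<one>\<^bsub>pos_reals_group\<^esub>" by blast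
  qed (simp_all add: pos_reals_group_def)
  moreover have "group nonzero_reals_group"
  proof (rule groupI)
    fix x assume "x \<in> carrier nonzero_reals_group"
    then have "inverse x \<in> carrier nonzero_reals_group" "inverse x \<otimes>\<^bsub>nonzero_reals_group\<^esub> x = \<one>\<^bsub>nonzero_reals_group\<^esub>"
      by (simp_all add: nonzero_reals_group_def)
    then show "\<exists>y\<in>carrier nonzero_reals_group. y \<otimes>\<^bsub>nonzero_reals_group\<^esub> x = \<one>\<^bsub>nonzero_reals_group\<^esub>" by blast
  qed (simp_all add: nonzero_reals_group_def)
  ultimately show ?thesis
    unfolding G_group_def by (intro DirProd_group semidirect_group)
qed

abbreviation G_elt_of :: "real \<Rightarrow> real \<Rightarrow> real \<Rightarrow> int^2^2 \<Rightarrow> int^2 \<Rightarrow> G_elt" where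
  "G_elt_of \<alpha> \<mu> \<rho> K k \<equiv> ((\<mu>, \<rho>), (K, theta_coset (theta_of \<alpha>) k))"

lemma G_group_carrier:
  "g \<in> carrier (G_group \<alpha>) \<longleftrightarrow>
    (\<exists>\<mu> \<rho> K k. g = G_elt_of \<alpha> \<mu> \<rho> K k \<and> \<mu> > 0 \<and> \<rho> \<noteq> 0 \<and> invertible K)"
  by (auto simp: G_group_def DirProd_def pos_reals_group_def nonzero_reals_group_def semidirect_carrier)

lemma G_group_mult:
  assumes "invertible L"
  shows "G_elt_of \<alpha> \<mu> \<rho> K k \<otimes>\<^bsub>G_group \<alpha>\<^esub> G_elt_of \<alpha> \<mu>' \<rho>' L l
    = G_elt_of \<alpha> (\<mu> * \<mu>') (\<rho> * \<rho>') (K ** L) (k v* L + l)"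
  by (simp add: G_group_def DirProd_def pos_reals_group_def nonzero_reals_group_def semidirect_mult[OF assms])

lemma G_group_one: "\<one>\<^bsub>G_group \<alpha>\<^esub> = G_elt_of \<alpha> 1 1 (mat 1) 0"
  by (simp add: G_group_def DirProd_def pos_reals_group_def nonzero_reals_group_def semidirect_one)

section \<open>The group actions\<close>

text \<open>The group applies the scaling first; it is pulled to the front here because it commutes
  with the other two operations on representatives.\<close>

definition c_act :: "real \<Rightarrow> real \<Rightarrow> real \<Rightarrow> int^2^2 \<Rightarrow> int^2 \<Rightarrow> real^2 \<Rightarrow> real^2 \<Rightarrow> real^2 \<Rightarrow> real^2" where
  "c_act \<alpha> \<mu> \<rho> K k a b c = (\<mu> * \<rho>) *\<^sub>R GL_rep K a b (trans_rep \<alpha> k a b c)"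

lemma matrix_vector_mult_add_scale: "(K :: int^2^2) *v (p + int r *s q) = K *v p + int r *s (K *v q)"
  by (simp add: vec_eq_iff matrix_vector_mult_def sum_2 algebra_simps)

text \<open>Both the translation by \<open>k\<close> and the half-integral defect of
  \<open>K\<close> contribute multiples of \<open>r\<close>, so they are merged into a single
  \<open>m\<close>.\<close>

lemma c_equation_act:
  assumes "\<alpha> > 1" "(a, b) \<in> P_minus \<alpha>" "r \<ge> 1" "invertible K" "\<mu> \<noteq> 0" "\<rho> \<noteq> 0"
    and "c_equation \<alpha> r a b c p"
  shows "\<exists>m. c_equation \<alpha> r (\<mu> *\<^sub>R (mat_of_int K *v a)) (\<rho> *\<^sub>R (mat_of_int K *v b))
    (c_act \<alpha> \<mu> \<rho> K k a b c) (det K *s (K *v p) + int r *s m)"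
proof -
  have \<alpha>: "\<alpha> \<noteq> 0" using assms(1) by simp
  have P: "(mat_of_int K *v a, mat_of_int K *v b) \<in> P_minus \<alpha>"
    using P_minus_action(1)[OF \<alpha> assms(2,4), of 1 1] by simp
  obtain m where "c_equation \<alpha> r (mat_of_int K *v a) (mat_of_int K *v b)
      (GL_rep K a b (trans_rep \<alpha> k a b c)) (det K *s (K *v (p + int r *s rot k)) + int r *s m)"
    using c_equation_GL[OF assms(1-4) c_equation_trans[OF assms(1-3,7)]] by blast
  moreover have "det K *s (K *v (p + int r *s rot k)) + int r *s m
      = det K *s (K *v p) + int r *s (det K *s (K *v rot k) + m)"
    unfolding matrix_vector_mult_add_scale by (simp add: vec_eq_iff algebra_simps)
  ultimately show ?thesis
    using c_equation_scale[OF assms(1) P assms(5,6)] unfolding c_act_def by metis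
qed

lemma c_act_in_C_set:
  assumes "\<alpha> > 1" "(a, b) \<in> P_minus \<alpha>" "r \<ge> 1" "invertible K" "\<mu> \<noteq> 0" "\<rho> \<noteq> 0" "c \<in> C_set \<alpha> r a b"
  shows "c_act \<alpha> \<mu> \<rho> K k a b c \<in> C_set \<alpha> r (\<mu> *\<^sub>R (mat_of_int K *v a)) (\<rho> *\<^sub>R (mat_of_int K *v b))"
  using assms c_equation_act[OF assms(1-6)] unfolding C_set_def by blast

text \<open>The lattice correction inherited from \<open>GL_rep_mult\<close> has to be expressed in
  the lattice of the transformed pair, where the classes are compared.\<close>

lemma c_act_compose:
  assumes "r \<ge> 1" "invertible K" "invertible L"
  shows "\<exists>m. c_act \<alpha> \<mu> \<rho> K k (\<mu>' *\<^sub>R (mat_of_int L *v a)) (\<rho>' *\<^sub>R (mat_of_int L *v b)) (c_act \<alpha> \<mu>' \<rho>' L l a b c)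
    = c_act \<alpha> (\<mu> * \<mu>') (\<rho> * \<rho>') (K ** L) (k v* L + l) a b c
      + (wedge ((\<rho> * \<rho>') *\<^sub>R (mat_of_int (K ** L) *v b)) ((\<mu> * \<mu>') *\<^sub>R (mat_of_int (K ** L) *v a)) / real r) *\<^sub>R vec_of_int m"
proof -
  let ?y = "trans_rep \<alpha> (k v* L + l) a b c"
  obtain m where m: "GL_rep K (mat_of_int L *v a) (mat_of_int L *v b) (GL_rep L a b ?y)
    = GL_rep (K ** L) a b ?y + (wedge b a / real r) *\<^sub>R vec_of_int m"
    using GL_rep_mult[OF assms(1)] by blast
  \<comment> \<open>The wedge of the transformed pair carries the extra factor \<open>d\<close>; as
    \<open>d * d = 1\<close>, the integer vector \<open>d *s m\<close> compensates for it.\<close>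
  define d where "d = det (K ** L)"
  have dd: "real_of_int d * real_of_int d = 1"
    using invertible_int_det[OF invertible_int_mult[OF assms(2,3)]] by (auto simp: d_def)
  have "c_act \<alpha> \<mu> \<rho> K k (\<mu>' *\<^sub>R (mat_of_int L *v a)) (\<rho>' *\<^sub>R (mat_of_int L *v b)) (c_act \<alpha> \<mu>' \<rho>' L l a b c)
      = (\<mu> * \<rho> * (\<mu>' * \<rho>')) *\<^sub>R GL_rep K (mat_of_int L *v a) (mat_of_int L *v b) (GL_rep L a b ?y)"
    by (simp add: c_act_def trans_rep_scale GL_rep_scale trans_rep_GL_rep trans_rep_add)
  also have "\<dots> = (\<mu> * \<mu>' * (\<rho> * \<rho>')) *\<^sub>R GL_rep (K ** L) a b ?y
      + (\<mu> * \<rho> * (\<mu>' * \<rho>') * (wedge b a / real r)) *\<^sub>R vec_of_int m"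
    unfolding m by (simp add: scaleR_add_right mult_ac)
  also have "\<mu> * \<rho> * (\<mu>' * \<rho>') * (wedge b a / real r) =
     (\<rho> * \<rho>' * (\<mu> * \<mu>') * (of_int d * wedge b a)) / real r * of_int d"
  proof -
    have "(\<rho> * \<rho>' * (\<mu> * \<mu>') * (of_int d * wedge b a)) / real r * of_int d
      = (\<rho> * \<rho>' * (\<mu> * \<mu>') * wedge b a) / real r * (of_int d * of_int d)" by simp
    then show ?thesis unfolding dd by (simp add: mult_ac)
  qed
  finally show ?thesis
    unfolding wedge_scaleR wedge_mult d_def[symmetric] c_act_def
    by (intro exI[of _ "d *s m"]) (simp add: vec_of_int_scale)
qed

lemma GL_rep_one: "GL_rep (mat 1) a b c = c"
proof -
  have "row_prods (mat 1) = 0" by (simp add: row_prods_def mat_def vec_eq_iff)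
  then have "vec_of_int (row_prods (mat 1)) = 0" by (simp add: vec_of_int_def vec_eq_iff)
  then show ?thesis by (simp add: GL_rep_def mat_of_int_one)
qed

lemma trans_rep_zero: "trans_rep \<alpha> 0 a b c = c"
  by (simp add: trans_rep_def row_times_def)

lemma c_act_one: "c_act \<alpha> 1 1 (mat 1) 0 a b c = c"
  by (simp add: c_act_def GL_rep_one trans_rep_zero)

lemma T_quot_iff:
  "x \<in> T_quot \<alpha> r \<longleftrightarrow> (\<exists>a b c. x = (a, b, c_class r a b c) \<and> (a, b) \<in> P_minus \<alpha> \<and> c \<in> C_set \<alpha> r a b)"
  by (force simp: T_quot_def T_proj_def T_set_def)

text \<open>Turns the action, which is defined by images and unions of cosets, into a computation
  with one representative.\<close>

lemma G_act_T_class: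
  assumes "S_minus_admissible \<alpha>" "(a, b) \<in> P_minus \<alpha>" "r \<ge> 1" "c \<in> C_set \<alpha> r a b"
    and "invertible K" "\<mu> > 0" "\<rho> \<noteq> 0"
  shows "G_act_T \<alpha> r (G_elt_of \<alpha> \<mu> \<rho> K k) (a, b, c_class r a b c)
    = (\<mu> *\<^sub>R (mat_of_int K *v a), \<rho> *\<^sub>R (mat_of_int K *v b),
       c_class r (\<mu> *\<^sub>R (mat_of_int K *v a)) (\<rho> *\<^sub>R (mat_of_int K *v b)) (c_act \<alpha> \<mu> \<rho> K k a b c))"
proof -
  have "\<alpha> > 1" using assms(1) admissible_facts(1) by (auto simp: S_minus_admissible_def)
  then have P: "(\<mu> *\<^sub>R a, \<rho> *\<^sub>R b) \<in> P_minus \<alpha>" using P_minus_scale(1)[of \<alpha> a b \<mu> \<rho>] assms by simp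
  have x: "(a, b, c_class r a b c) \<in> T_quot \<alpha> r" using assms T_quot_iff by blast
  show ?thesis
    using x by (simp add: G_act_T_def scale_act_class trans_act_class[OF assms(1) P assms(3)]
      GL_act_class[OF assms(5)] trans_rep_scale GL_rep_scale c_act_def matrix_vector_mult_scaleR)
qed

lemma G_act_P_eq:
  assumes "(a, b) \<in> P_minus \<alpha>"
  shows "G_act_P \<alpha> (G_elt_of \<alpha> \<mu> \<rho> K k) (a, b) = (\<mu> *\<^sub>R (mat_of_int K *v a), \<rho> *\<^sub>R (mat_of_int K *v b))"
  using assms by (simp add: G_act_P_def)

lemma admissible_gt_1: "S_minus_admissible \<alpha> \<Longrightarrow> \<alpha> > 1"
  using admissible_facts(1) by (auto simp: S_minus_admissible_def)

lemma G_act_T_group_action: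
  assumes "S_minus_admissible \<alpha>" "r \<ge> 1"
  shows "group_action (G_group \<alpha>) (T_quot \<alpha> r) (G_act_T \<alpha> r)"
proof (rule group_actionI[OF G_group_group])
  have \<alpha>: "\<alpha> > 1" "\<alpha> \<noteq> 0" using admissible_gt_1[OF assms(1)] by auto
  note act = G_act_T_class[OF assms(1) _ assms(2)]
  {
    fix g x assume "g \<in> carrier (G_group \<alpha>)" "x \<in> T_quot \<alpha> r"
    then obtain \<mu> \<rho> K k a b c where g: "g = G_elt_of \<alpha> \<mu> \<rho> K k" "\<mu> > 0" "\<rho> \<noteq> 0" "invertible K"
      and x: "x = (a, b, c_class r a b c)" "(a, b) \<in> P_minus \<alpha>" "c \<in> C_set \<alpha> r a b"
      unfolding G_group_carrier T_quot_iff by blast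
    have \<mu>: "\<mu> \<noteq> 0" using g(2) by simp
    show "G_act_T \<alpha> r g x \<in> T_quot \<alpha> r"
      unfolding g(1) x(1) act[OF x(2,3) g(4,2,3)] T_quot_iff
      using P_minus_action(1)[OF \<alpha>(2) x(2) g(4) \<mu> g(3)]
        c_act_in_C_set[OF \<alpha>(1) x(2) assms(2) g(4) \<mu> g(3) x(3)] by blast
  next
    fix g assume "g \<in> carrier (G_group \<alpha>)"
    then show "G_act_T \<alpha> r g \<in> extensional (T_quot \<alpha> r)"
      unfolding G_group_carrier by (auto simp: G_act_T_def)
  next
    fix g h x
    assume "g \<in> carrier (G_group \<alpha>)" "h \<in> carrier (G_group \<alpha>)" "x \<in> T_quot \<alpha> r"
    then obtain \<mu> \<rho> K k \<mu>' \<rho>' L l a b c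
      where g: "g = G_elt_of \<alpha> \<mu> \<rho> K k" "\<mu> > 0" "\<rho> \<noteq> 0" "invertible K"
      and h: "h = G_elt_of \<alpha> \<mu>' \<rho>' L l" "\<mu>' > 0" "\<rho>' \<noteq> 0" "invertible L"
      and x: "x = (a, b, c_class r a b c)" "(a, b) \<in> P_minus \<alpha>" "c \<in> C_set \<alpha> r a b"
      unfolding G_group_carrier T_quot_iff by blast
    have P: "(\<mu>' *\<^sub>R (mat_of_int L *v a), \<rho>' *\<^sub>R (mat_of_int L *v b)) \<in> P_minus \<alpha>"
      using P_minus_action(1)[OF \<alpha>(2) x(2) h(4)] h(2,3) by simp
    have C: "c_act \<alpha> \<mu>' \<rho>' L l a b c \<in> C_set \<alpha> r (\<mu>' *\<^sub>R (mat_of_int L *v a)) (\<rho>' *\<^sub>R (mat_of_int L *v b))"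
      using c_act_in_C_set[OF \<alpha>(1) x(2) assms(2) h(4) _ h(3) x(3)] h(2) by simp
    have pos: "\<mu> * \<mu>' > 0" "\<rho> * \<rho>' \<noteq> 0" using g h by auto
    have mv: "s *\<^sub>R (mat_of_int K *v (t *\<^sub>R (mat_of_int L *v y))) = (s * t) *\<^sub>R (mat_of_int (K ** L) *v y)"
      for s t y by (simp add: matrix_vector_mult_scaleR mat_of_int_mult matrix_vector_mul_assoc)
    let ?A = "(\<mu> * \<mu>') *\<^sub>R (mat_of_int (K ** L) *v a)" and ?B = "(\<rho> * \<rho>') *\<^sub>R (mat_of_int (K ** L) *v b)"
    \<comment> \<open>The composition law fails on representatives by a lattice vector only, so it
      holds for classes.\<close>
    have "c_class r ?A ?B (c_act \<alpha> \<mu> \<rho> K k (\<mu>' *\<^sub>R (mat_of_int L *v a)) (\<rho>' *\<^sub>R (mat_of_int L *v b)) (c_act \<alpha> \<mu>' \<rho>' L l a b c))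
      = c_class r ?A ?B (c_act \<alpha> (\<mu> * \<mu>') (\<rho> * \<rho>') (K ** L) (k v* L + l) a b c)"
      unfolding c_class_eq_iff by (rule c_act_compose[OF assms(2) g(4) h(4)])
    then show "G_act_T \<alpha> r (g \<otimes>\<^bsub>G_group \<alpha>\<^esub> h) x = G_act_T \<alpha> r g (G_act_T \<alpha> r h x)"
      unfolding g(1) h(1) x(1) G_group_mult[OF h(4)] act[OF x(2,3) h(4,2,3)] act[OF P C g(4,2,3)]
        act[OF x(2,3) invertible_int_mult[OF g(4) h(4)] pos] mv by simp
  next
    fix x assume "x \<in> T_quot \<alpha> r"
    then obtain a b c where x: "x = (a, b, c_class r a b c)" "(a, b) \<in> P_minus \<alpha>" "c \<in> C_set \<alpha> r a b"
      unfolding T_quot_iff by blast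
    show "G_act_T \<alpha> r \<one>\<^bsub>G_group \<alpha>\<^esub> x = x"
      using act[OF x(2,3) invertible_int_one, of 1 1 0]
      by (simp add: x(1) G_group_one c_act_one mat_of_int_one)
  }
qed

lemma G_act_P_group_action:
  assumes "\<alpha> \<noteq> 0"
  shows "group_action (G_group \<alpha>) (P_minus \<alpha>) (G_act_P \<alpha>)"
proof (rule group_actionI[OF G_group_group])
  fix g x assume "g \<in> carrier (G_group \<alpha>)" "x \<in> P_minus \<alpha>"
  then show "G_act_P \<alpha> g x \<in> P_minus \<alpha>"
    unfolding G_group_carrier
    by (cases x) (auto simp: G_act_P_eq intro!: P_minus_action(1)[OF assms])
next
  fix g assume "g \<in> carrier (G_group \<alpha>)"
  then show "G_act_P \<alpha> g \<in> extensional (P_minus \<alpha>)"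
    unfolding G_group_carrier by (auto simp: G_act_P_def)
next
  fix g h x assume "g \<in> carrier (G_group \<alpha>)" "h \<in> carrier (G_group \<alpha>)" and x: "x \<in> P_minus \<alpha>"
  then obtain \<mu> \<rho> K k \<mu>' \<rho>' L l
    where g: "g = G_elt_of \<alpha> \<mu> \<rho> K k" "\<mu> > 0" "\<rho> \<noteq> 0" "invertible K"
      and h: "h = G_elt_of \<alpha> \<mu>' \<rho>' L l" "\<mu>' > 0" "\<rho>' \<noteq> 0" "invertible L"
    unfolding G_group_carrier by blast
  obtain a b where ab: "x = (a, b)" "(a, b) \<in> P_minus \<alpha>" using x by (cases x) auto
  have P: "(\<mu>' *\<^sub>R (mat_of_int L *v a), \<rho>' *\<^sub>R (mat_of_int L *v b)) \<in> P_minus \<alpha>"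
    using P_minus_action(1)[OF assms ab(2) h(4)] h(2,3) by simp
  show "G_act_P \<alpha> (g \<otimes>\<^bsub>G_group \<alpha>\<^esub> h) x = G_act_P \<alpha> g (G_act_P \<alpha> h x)"
    unfolding g(1) h(1) ab(1) G_group_mult[OF h(4)] G_act_P_eq[OF ab(2)] G_act_P_eq[OF P]
    by (simp add: matrix_vector_mult_scaleR mat_of_int_mult matrix_vector_mul_assoc)
next
  fix x assume "x \<in> P_minus \<alpha>"
  then show "G_act_P \<alpha> \<one>\<^bsub>G_group \<alpha>\<^esub> x = x"
    by (cases x) (simp add: G_group_one G_act_P_eq mat_of_int_one)
qed

section \<open>Fibres and the topology of the orbit space\<close>

lemma (in group_action) orbit_eq_iff:
  assumes "x \<in> E" "y \<in> E"
  shows "orbit G \<phi> x = orbit G \<phi> y \<longleftrightarrow> (\<exists>g\<in>carrier G. \<phi> g x = y)"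
proof -
  have "orbit G \<phi> x = orbit G \<phi> y \<longleftrightarrow> y \<in> orbit G \<phi> x"
    using assms orbit_refl disjoint_union[of "orbit G \<phi> x" "orbit G \<phi> y"]
    unfolding orbits_def by blast
  then show ?thesis by (auto simp: orbit_def)
qed

text \<open>Two surjections from one set with equal fibres have the same quotient. Well-definedness
  and injectivity of the induced map are the two directions of \<open>kernel\<close>.\<close>

lemma ex_bij_betw_of_same_kernel:
  assumes "q ` X = A" "q' ` X = B"
    and kernel: "\<And>x y. x \<in> X \<Longrightarrow> y \<in> X \<Longrightarrow> q x = q y \<longleftrightarrow> q' x = q' y"
  shows "\<exists>f. bij_betw f A B \<and> (\<forall>x\<in>X. f (q x) = q' x)"
proof -
  define f where "f = q' \<circ> inv_into X q"
  have f: "f (q x) = q' x" if "x \<in> X" for x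
    using that kernel[of "inv_into X q (q x)" x] by (simp add: f_def inv_into_into f_inv_into_f)
  have "inj_on f A" unfolding assms(1)[symmetric] by (auto simp: inj_on_def f kernel)
  moreover have "f ` A = B" unfolding assms(1,2)[symmetric] image_image by (simp add: f)
  ultimately show ?thesis using f by (auto simp: bij_betw_def)
qed

lemma T_quot_pair_iff: "(a, b, \<gamma>) \<in> T_quot \<alpha> r \<longleftrightarrow> (a, b) \<in> P_minus \<alpha> \<and> \<gamma> \<in> C_quot \<alpha> r a b"
  unfolding T_quot_iff C_quot_def by (simp add: image_iff) blast

text \<open>Equivariance of forgetting the third component, which can therefore stay
  unspecified.\<close>

lemma G_act_T_pair:
  assumes "S_minus_admissible \<alpha>" "r \<ge> 1" "(a, b, \<gamma>) \<in> T_quot \<alpha> r" "g \<in> carrier (G_group \<alpha>)"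
  obtains \<gamma>' where "G_act_T \<alpha> r g (a, b, \<gamma>) = (fst (G_act_P \<alpha> g (a, b)), snd (G_act_P \<alpha> g (a, b)), \<gamma>')"
proof -
  obtain \<mu> \<rho> K k where g: "g = G_elt_of \<alpha> \<mu> \<rho> K k" "\<mu> > 0" "\<rho> \<noteq> 0" "invertible K"
    using assms(4) unfolding G_group_carrier by blast
  obtain c where c: "\<gamma> = c_class r a b c" "(a, b) \<in> P_minus \<alpha>" "c \<in> C_set \<alpha> r a b"
    using assms(3) unfolding T_quot_iff by blast
  show ?thesis
    using that unfolding g(1) c(1) G_act_T_class[OF assms(1) c(2) assms(2) c(3) g(4,2,3)]
      G_act_P_eq[OF c(2)] by simp
qed

section \<open>The induced maps and their fibres\<close>

lemma Phi_Q_class: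
  assumes "S_minus_admissible \<alpha>" "r \<ge> 1" "(a, b, \<gamma>) \<in> T_quot \<alpha> r"
  shows "Phi (Q_class \<alpha> r (a, b, \<gamma>)) = P_class \<alpha> (a, b)"
proof -
  have "(\<lambda>(a, b, \<gamma>). (a, b)) (G_act_T \<alpha> r g (a, b, \<gamma>)) = G_act_P \<alpha> g (a, b)"
    if g: "g \<in> carrier (G_group \<alpha>)" for g
  proof -
    obtain \<gamma>' where "G_act_T \<alpha> r g (a, b, \<gamma>) = (fst (G_act_P \<alpha> g (a, b)), snd (G_act_P \<alpha> g (a, b)), \<gamma>')"
      by (rule G_act_T_pair[OF assms g])
    then show ?thesis by simp
  qed
  then show ?thesis
    unfolding Phi_def Q_class_def P_class_def orbit_def Setcompr_eq_image image_image
    by (intro image_cong refl)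
qed

text \<open>\<open>Psi\<close> factors through \<open>Phi\<close>, which yields one inclusion
  between the fibres at once.\<close>

lemma Psi_eq_image_Phi: "Psi \<alpha> \<omega> = (\<lambda>(a, b). N_of \<alpha> a b) ` Phi \<omega>"
  by (simp add: Psi_def Phi_def image_image case_prod_unfold)

lemma image_P_class:
  assumes "\<alpha> > 0" "(a, b) \<in> P_minus \<alpha>"
  shows "(\<lambda>(a, b). N_of \<alpha> a b) ` P_class \<alpha> (a, b) = N_class \<alpha> (N_of \<alpha> a b)"
proof -
  have \<alpha>: "\<alpha> \<noteq> 0" using assms(1) by simp
  have N: "(\<lambda>(a, b). N_of \<alpha> a b) (G_act_P \<alpha> (G_elt_of \<alpha> \<mu> \<rho> K k) (a, b)) = conj_act \<alpha> K (N_of \<alpha> a b)"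
    if "\<mu> > 0" "\<rho> \<noteq> 0" "invertible K" for \<mu> \<rho> K k
    using that P_minus_action(2)[OF \<alpha> assms(2)] N_of_in_N_minus[OF assms]
    by (simp add: G_act_P_eq[OF assms(2)] conj_act_def)
  show ?thesis
  proof (intro equalityI subsetI)
    fix M assume "M \<in> (\<lambda>(a, b). N_of \<alpha> a b) ` P_class \<alpha> (a, b)"
    then obtain g where "g \<in> carrier (G_group \<alpha>)" "M = (\<lambda>(a, b). N_of \<alpha> a b) (G_act_P \<alpha> g (a, b))"
      unfolding P_class_def orbit_def by blast
    then show "M \<in> N_class \<alpha> (N_of \<alpha> a b)"
      unfolding G_group_carrier N_class_def orbit_def using N by (metis (mono_tags, lifting) GL2Z_simps(1) mem_Collect_eq)
  next
    fix M assume "M \<in> N_class \<alpha> (N_of \<alpha> a b)"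
    then obtain K where K: "invertible K" "M = conj_act \<alpha> K (N_of \<alpha> a b)"
      unfolding N_class_def orbit_def by auto
    \<comment> \<open>Scalings and translations do not affect the matrix, so trivial ones
      suffice.\<close>
    have "G_elt_of \<alpha> 1 1 K 0 \<in> carrier (G_group \<alpha>)"
      unfolding G_group_carrier using K(1) by force
    then show "M \<in> (\<lambda>(a, b). N_of \<alpha> a b) ` P_class \<alpha> (a, b)"
      unfolding K(2) P_class_def orbit_def using N[OF _ _ K(1), of 1 1 0] by (smt (verit) image_iff mem_Collect_eq)
  qed
qed

text \<open>Conjugate matrices have the same eigenlines up to \<open>K\<close>; replacing \<open>K\<close> by \<open>-K\<close> makes the
  first scaling factor positive.\<close>

lemma P_class_eqI:
  assumes "\<alpha> > 0" "(a, b) \<in> P_minus \<alpha>" "(a', b') \<in> P_minus \<alpha>"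
    and "N_of \<alpha> a' b' \<in> N_class \<alpha> (N_of \<alpha> a b)"
  shows "P_class \<alpha> (a', b') = P_class \<alpha> (a, b)"
proof -
  have \<alpha>: "\<alpha> \<noteq> 0" using assms(1) by simp
  interpret group_action "G_group \<alpha>" "P_minus \<alpha>" "G_act_P \<alpha>" by (rule G_act_P_group_action[OF \<alpha>])
  obtain K where K: "invertible K" "N_of \<alpha> a' b' = K ** N_of \<alpha> a b ** matrix_inv K"
    using assms(4) N_of_in_N_minus[OF assms(1,2)] unfolding N_class_def orbit_def conj_act_def by auto
  obtain \<mu> \<rho> where m: "\<mu> \<noteq> 0" "\<rho> \<noteq> 0" "a' = \<mu> *\<^sub>R (mat_of_int K *v a)" "b' = \<rho> *\<^sub>R (mat_of_int K *v b)"
    using P_minus_same_N[OF assms(1) P_minus_action(1)[OF \<alpha> assms(2) K(1), of 1 1] assms(3)]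
      P_minus_action(2)[OF \<alpha> assms(2) K(1), of 1 1] K(2) by auto
  have "\<exists>L s t. invertible L \<and> s > 0 \<and> t \<noteq> 0 \<and> a' = s *\<^sub>R (mat_of_int L *v a) \<and> b' = t *\<^sub>R (mat_of_int L *v b)"
  proof (cases "\<mu> > 0")
    case True
    then show ?thesis using m K(1) by blast
  next
    case False
    have neg: "mat_of_int (- K) *v x = - (mat_of_int K *v x)" for x
      by (simp add: vec_eq_iff matrix_vector_mult_def sum_2)
    have "(- K) ** (- matrix_inv K) = mat 1" "(- matrix_inv K) ** (- K) = mat 1"
      using invertible_int_inverses(1,2)[OF K(1)]
      by (simp_all add: vec_eq_iff matrix_matrix_mult_def)
    then have "invertible (- K)" unfolding invertible_def by blast
    \<comment> \<open>The sign of \<rho> changes as well, which is harmless since \<rho> may have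
      either sign.\<close>
    moreover have "a' = (- \<mu>) *\<^sub>R (mat_of_int (- K) *v a)" "b' = (- \<rho>) *\<^sub>R (mat_of_int (- K) *v b)"
      unfolding neg m(3,4) by simp_all
    moreover have "- \<mu> > 0" "- \<rho> \<noteq> 0" using False m(1,2) by auto
    ultimately show ?thesis by blast
  qed
  then obtain L s t where L: "invertible L" "s > 0" "t \<noteq> 0" "a' = s *\<^sub>R (mat_of_int L *v a)" "b' = t *\<^sub>R (mat_of_int L *v b)"
    by blast
  have "G_elt_of \<alpha> s t L 0 \<in> carrier (G_group \<alpha>)" unfolding G_group_carrier using L(1-3) by blast
  moreover have "G_act_P \<alpha> (G_elt_of \<alpha> s t L 0) (a, b) = (a', b')"
    unfolding G_act_P_eq[OF assms(2)] L(4,5) ..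
  ultimately show ?thesis
    unfolding P_class_def using orbit_eq_iff[OF assms(2,3)] by blast
qed

text \<open>The conjugacy class of the matrix determines the class of the pair, so the map from
  classes of pairs to conjugacy classes is injective.\<close>

lemma Phi_fibre_eq_Psi_fibre:
  assumes "S_minus_admissible \<alpha>" "r \<ge> 1" "(a, b) \<in> P_minus \<alpha>"
  shows "Phi_fibre \<alpha> r (P_class \<alpha> (a, b)) = Psi_fibre \<alpha> r (N_class \<alpha> (N_of \<alpha> a b))"
proof -
  have \<alpha>: "\<alpha> > 0" using admissible_gt_1[OF assms(1)] by simp
  have "Phi \<omega> = P_class \<alpha> (a, b) \<longleftrightarrow> Psi \<alpha> \<omega> = N_class \<alpha> (N_of \<alpha> a b)" if \<omega>: "\<omega> \<in> Q_minus \<alpha> r" for \<omega>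
  proof
    assume "Phi \<omega> = P_class \<alpha> (a, b)"
    then show "Psi \<alpha> \<omega> = N_class \<alpha> (N_of \<alpha> a b)"
      by (simp add: Psi_eq_image_Phi image_P_class[OF \<alpha> assms(3)])
  next
    assume Psi: "Psi \<alpha> \<omega> = N_class \<alpha> (N_of \<alpha> a b)"
    obtain a' b' \<gamma> where x: "(a', b', \<gamma>) \<in> T_quot \<alpha> r" "\<omega> = Q_class \<alpha> r (a', b', \<gamma>)"
      using \<omega> unfolding Q_minus_def orbits_def Q_class_def by auto
    have Phi: "Phi \<omega> = P_class \<alpha> (a', b')" using Phi_Q_class[OF assms(1,2) x(1)] x(2) by simp
    have P: "(a', b') \<in> P_minus \<alpha>" using x(1) T_quot_pair_iff by blast
    interpret group_action "G_group \<alpha>" "P_minus \<alpha>" "G_act_P \<alpha>"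
      using G_act_P_group_action \<alpha> by simp
    \<comment> \<open>The pair \<open>(a', b')\<close> lies in its own orbit, so its matrix lies in
      the image of that orbit, which is the given conjugacy class.\<close>
    have "N_of \<alpha> a' b' \<in> N_class \<alpha> (N_of \<alpha> a b)"
      using orbit_refl[OF P] unfolding Psi[symmetric] Psi_eq_image_Phi Phi P_class_def by force
    then show "Phi \<omega> = P_class \<alpha> (a, b)" using P_class_eqI[OF \<alpha> assms(3) P] Phi by simp
  qed
  then show ?thesis by (auto simp: Phi_fibre_def Psi_fibre_def)
qed

lemma c_equation_p_of:
  assumes "wedge a b \<noteq> 0" "r \<ge> 1" "c \<in> C_set \<alpha> r a b"
  shows "c_equation \<alpha> r a b c (p_of \<alpha> r a b c)"
proof -
  obtain p where "c_equation \<alpha> r a b c p" using assms(3) by (auto simp: C_set_def)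
  then show ?thesis using p_of_eq[OF assms(1,2)] by simp
qed

section \<open>Discreteness of the orbit space\<close>

text \<open>Equal matrices make the pairs proportional by some \<mu>, \<rho>; the inner product
  forces \<mu> > 0; and since \<open>p\<close> determines \<open>c\<close>, equal \<open>p\<close>
  forces c' = \<mu>\<rho> c. A pure scaling thus joins the two points. This is the local constancy
  of the orbit map.\<close>

lemma Q_class_eqI:
  assumes adm: "S_minus_admissible \<alpha>" and r: "r \<ge> 1"
    and x: "(a, b, c) \<in> T_set \<alpha> r" and x': "(a', b', c') \<in> T_set \<alpha> r"
    and N: "N_of \<alpha> a' b' = N_of \<alpha> a b" and p: "p_of \<alpha> r a' b' c' = p_of \<alpha> r a b c"
    and pos: "a \<bullet> a' > 0"
  shows "Q_class \<alpha> r (a', b', c_class r a' b' c') = Q_class \<alpha> r (a, b, c_class r a b c)"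
proof -
  have \<alpha>: "\<alpha> > 1" "\<alpha> > 0" "\<alpha> \<noteq> 0" using admissible_gt_1[OF adm] by auto
  have P: "(a, b) \<in> P_minus \<alpha>" "c \<in> C_set \<alpha> r a b" and P': "(a', b') \<in> P_minus \<alpha>" "c' \<in> C_set \<alpha> r a' b'"
    using x x' by (auto simp: T_set_def)
  interpret group_action "G_group \<alpha>" "T_quot \<alpha> r" "G_act_T \<alpha> r" by (rule G_act_T_group_action[OF adm r])
  obtain \<mu> \<rho> where m: "\<mu> \<noteq> 0" "\<rho> \<noteq> 0" "a' = \<mu> *\<^sub>R a" "b' = \<rho> *\<^sub>R b"
    using P_minus_same_N[OF \<alpha>(2) P(1) P'(1) N] by blast
  have "0 < \<mu> * (a \<bullet> a)" using pos m(3) by simp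
  then have \<mu>: "\<mu> > 0" using inner_ge_zero[of a] zero_less_mult_iff[of \<mu> "a \<bullet> a"] by linarith
  have "c_equation \<alpha> r a' b' ((\<mu> * \<rho>) *\<^sub>R c) (p_of \<alpha> r a b c)"
    unfolding m(3,4)
    by (rule c_equation_scale[OF \<alpha>(1) P(1) m(1,2) c_equation_p_of[OF P_minus_facts(1)[OF \<alpha>(3) P(1)] r P(2)]])
  then have c': "c' = (\<mu> * \<rho>) *\<^sub>R c"
    using c_equation_c_unique[OF \<alpha>(1) P'(1)] c_equation_p_of[OF P_minus_facts(1)[OF \<alpha>(3) P'(1)] r P'(2)] p by metis
  have "G_act_T \<alpha> r (G_elt_of \<alpha> \<mu> \<rho> (mat 1) 0) (a, b, c_class r a b c) = (a', b', c_class r a' b' c')"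
    using G_act_T_class[OF adm P(1) r P(2) invertible_int_one \<mu> m(2), of 0]
    by (simp add: c_act_def GL_rep_one trans_rep_zero mat_of_int_one m(3,4) c')
  moreover have "G_elt_of \<alpha> \<mu> \<rho> (mat 1) 0 \<in> carrier (G_group \<alpha>)"
    unfolding G_group_carrier using \<mu> m(2) invertible_int_one by blast
  moreover have "(a, b, c_class r a b c) \<in> T_quot \<alpha> r" "(a', b', c_class r a' b' c') \<in> T_quot \<alpha> r"
    using P P' T_quot_iff by blast+
  ultimately show ?thesis unfolding Q_class_def using orbit_eq_iff by metis
qed

lemma topspace_T_top: "topspace (T_top \<alpha> r) = T_set \<alpha> r"
  unfolding T_top_def topology_generated_by_topspace by auto

lemma openin_T_top_basic:
  "openin (T_top \<alpha> r) {(a, b, c) \<in> T_set \<alpha> r. N_of \<alpha> a b \<in> U}"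
  "openin (T_top \<alpha> r) {(a, b, c) \<in> T_set \<alpha> r. p_of \<alpha> r a b c \<in> V}"
  "open W \<Longrightarrow> openin (T_top \<alpha> r) {(a, b, c) \<in> T_set \<alpha> r. (a, b) \<in> W}"
  unfolding T_top_def by (rule topology_generated_by_Basis; blast)+

lemma T_quot_eq: "T_proj r ` T_set \<alpha> r = T_quot \<alpha> r"
  by (simp add: T_quot_def)

lemma Q_minus_top_discrete:
  assumes adm: "S_minus_admissible \<alpha>" and r: "r \<ge> 1"
  shows "Q_minus_top \<alpha> r = discrete_topology (Q_minus \<alpha> r)"
proof -
  \<comment> \<open>The two successive quotients form one quotient map, so openness of a point can
    be tested on triples in \<open>T_set\<close>.\<close>
  have q: "quotient_map (T_top \<alpha> r) (Q_minus_top \<alpha> r) (Q_class \<alpha> r \<circ> T_proj r)"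
    unfolding Q_minus_top_def T_quot_top_def
    by (rule quotient_map_compose[OF quotient_topology_quotient_map quotient_topology_quotient_map])
  have img: "(Q_class \<alpha> r \<circ> T_proj r) ` T_set \<alpha> r = Q_minus \<alpha> r"
    unfolding image_comp[symmetric] T_quot_eq by (auto simp: Q_minus_def orbits_def Q_class_def)
  then have top: "topspace (Q_minus_top \<alpha> r) = Q_minus \<alpha> r"
    using q by (simp add: quotient_map_def topspace_T_top)
  have "openin (Q_minus_top \<alpha> r) {\<omega>}" if \<omega>: "\<omega> \<in> Q_minus \<alpha> r" for \<omega>
  proof -
    define S where "S = {x \<in> T_set \<alpha> r. (Q_class \<alpha> r \<circ> T_proj r) x \<in> {\<omega>}}"
    have "\<exists>U. openin (T_top \<alpha> r) U \<and> x \<in> U \<and> U \<subseteq> S" if xS: "x \<in> S" for x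
    proof -
      obtain a b c where x: "x = (a, b, c)" "(a, b, c) \<in> T_set \<alpha> r" "Q_class \<alpha> r (a, b, c_class r a b c) = \<omega>"
        using xS by (cases x) (auto simp: S_def T_proj_def)
      \<comment> \<open>A half-plane condition on the first vector: it excludes the negative
        multiples of \<open>a\<close>, which cannot be told apart from \<open>a\<close> by the
        matrix.\<close>
      let ?W = "{z. a \<bullet> fst z > 0}"
      define U where "U = {(a', b', c') \<in> T_set \<alpha> r. N_of \<alpha> a' b' \<in> {N_of \<alpha> a b}}
         \<inter> {(a', b', c') \<in> T_set \<alpha> r. p_of \<alpha> r a' b' c' \<in> {p_of \<alpha> r a b c}}
         \<inter> {(a', b', c') \<in> T_set \<alpha> r. (a', b') \<in> ?W}"
      have "open ?W" by (intro open_Collect_less continuous_intros)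
      then have "openin (T_top \<alpha> r) U"
        unfolding U_def by (intro openin_Int openin_T_top_basic)
      moreover have "a \<noteq> 0"
        using x(2) P_minus_facts(1)[of \<alpha> a b] admissible_gt_1[OF adm] by (auto simp: T_set_def wedge_def)
      then have "x \<in> U" using x(1,2) by (simp add: U_def)
      moreover have "U \<subseteq> S"
        using Q_class_eqI[OF adm r x(2)] x(3) by (auto simp: U_def S_def T_proj_def)
      ultimately show ?thesis by blast
    qed
    then have "openin (T_top \<alpha> r) S" by (subst openin_subopen) blast
    moreover have "openin (T_top \<alpha> r) S = openin (Q_minus_top \<alpha> r) {\<omega>}"
    proof -
      have *: "\<forall>U\<subseteq>Q_minus \<alpha> r. openin (T_top \<alpha> r) {x \<in> T_set \<alpha> r. (Q_class \<alpha> r \<circ> T_proj r) x \<in> U}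
          = openin (Q_minus_top \<alpha> r) U"
        using q unfolding quotient_map_def topspace_T_top top by (rule conjunct2)
      show ?thesis unfolding S_def by (rule *[rule_format]) (use \<omega> in simp)
    qed
    ultimately show ?thesis by simp
  qed
  then show ?thesis using top by (metis discrete_topology_unique)
qed

lemma connected_components_Phi_fibre:
  assumes "S_minus_admissible \<alpha>" "r \<ge> 1"
  shows "connected_components_of (subtopology (Q_minus_top \<alpha> r) (Phi_fibre \<alpha> r y))
    = (\<lambda>\<omega>. {\<omega>}) ` Phi_fibre \<alpha> r y"
proof -
  have "Q_minus \<alpha> r \<inter> Phi_fibre \<alpha> r y = Phi_fibre \<alpha> r y" by (auto simp: Phi_fibre_def)
  then have "subtopology (Q_minus_top \<alpha> r) (Phi_fibre \<alpha> r y) = discrete_topology (Phi_fibre \<alpha> r y)"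
    unfolding Q_minus_top_discrete[OF assms] by simp
  then show ?thesis by (simp add: connected_components_of_discrete_topology)
qed

section \<open>Orbits in terms of $p$\<close>

lemma G_stab_simps:
  "g \<in> carrier (G_stab \<alpha> a b) \<longleftrightarrow> g \<in> carrier (G_group \<alpha>) \<and> G_act_P \<alpha> g (a, b) = (a, b)"
  "g \<otimes>\<^bsub>G_stab \<alpha> a b\<^esub> h = g \<otimes>\<^bsub>G_group \<alpha>\<^esub> h" "\<one>\<^bsub>G_stab \<alpha> a b\<^esub> = \<one>\<^bsub>G_group \<alpha>\<^esub>"
  by (simp_all add: G_stab_def stabilizer_def)

lemma G_stab_act_eq:
  assumes "S_minus_admissible \<alpha>" "r \<ge> 1" "(a, b) \<in> P_minus \<alpha>"
    and "g \<in> carrier (G_stab \<alpha> a b)" "\<gamma> \<in> C_quot \<alpha> r a b"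
  shows "G_act_T \<alpha> r g (a, b, \<gamma>) = (a, b, G_stab_act \<alpha> r a b g \<gamma>)"
    and "G_stab_act \<alpha> r a b g \<gamma> \<in> C_quot \<alpha> r a b"
proof -
  interpret T: group_action "G_group \<alpha>" "T_quot \<alpha> r" "G_act_T \<alpha> r"
    by (rule G_act_T_group_action[OF assms(1,2)])
  have x: "(a, b, \<gamma>) \<in> T_quot \<alpha> r" using assms(3,5) T_quot_pair_iff by blast
  have g: "g \<in> carrier (G_group \<alpha>)" "G_act_P \<alpha> g (a, b) = (a, b)" using assms(4) by (auto simp: G_stab_simps)
  show 1: "G_act_T \<alpha> r g (a, b, \<gamma>) = (a, b, G_stab_act \<alpha> r a b g \<gamma>)"
  proof -
    obtain \<gamma>' where "G_act_T \<alpha> r g (a, b, \<gamma>) = (a, b, \<gamma>')"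
      using G_act_T_pair[OF assms(1,2) x g(1)] g(2) by auto
    then show ?thesis using assms(5) by (simp add: G_stab_act_def)
  qed
  show "G_stab_act \<alpha> r a b g \<gamma> \<in> C_quot \<alpha> r a b"
    using T.element_image[OF g(1) x 1] T_quot_pair_iff by blast
qed

text \<open>The stabiliser preserves the slice of \<open>T_quot\<close> over \<open>(a, b)\<close>;
  the laws are inherited from the action on \<open>T_quot\<close>.\<close>

lemma G_stab_group_action:
  assumes "S_minus_admissible \<alpha>" "r \<ge> 1" "(a, b) \<in> P_minus \<alpha>"
  shows "group_action (G_stab \<alpha> a b) (C_quot \<alpha> r a b) (G_stab_act \<alpha> r a b)"
proof (rule group_actionI)
  have \<alpha>: "\<alpha> \<noteq> 0" using admissible_gt_1[OF assms(1)] by simp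
  interpret T: group_action "G_group \<alpha>" "T_quot \<alpha> r" "G_act_T \<alpha> r"
    by (rule G_act_T_group_action[OF assms(1,2)])
  interpret P: group_action "G_group \<alpha>" "P_minus \<alpha>" "G_act_P \<alpha>"
    by (rule G_act_P_group_action[OF \<alpha>])
  interpret G: group "G_group \<alpha>" by (rule G_group_group)
  note sub = P.stabilizer_subgroup[OF assms(3)]
  show grp: "group (G_stab \<alpha> a b)"
    unfolding G_stab_def by (rule subgroup.subgroup_is_group[OF sub G_group_group])
  note act = G_stab_act_eq[OF assms]
  have T: "(a, b, \<gamma>) \<in> T_quot \<alpha> r" if "\<gamma> \<in> C_quot \<alpha> r a b" for \<gamma>
    using that assms(3) T_quot_pair_iff by blast
  show "G_stab_act \<alpha> r a b g \<gamma> \<in> C_quot \<alpha> r a b"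
    if "g \<in> carrier (G_stab \<alpha> a b)" "\<gamma> \<in> C_quot \<alpha> r a b" for g \<gamma>
    by (rule act(2)[OF that])
  show "G_stab_act \<alpha> r a b g \<in> extensional (C_quot \<alpha> r a b)" for g
    by (simp add: G_stab_act_def)
  show "G_stab_act \<alpha> r a b (g \<otimes>\<^bsub>G_stab \<alpha> a b\<^esub> h) \<gamma> = G_stab_act \<alpha> r a b g (G_stab_act \<alpha> r a b h \<gamma>)"
    if gh: "g \<in> carrier (G_stab \<alpha> a b)" "h \<in> carrier (G_stab \<alpha> a b)" and \<gamma>: "\<gamma> \<in> C_quot \<alpha> r a b" for g h \<gamma>
  proof -
    have "g \<otimes>\<^bsub>G_stab \<alpha> a b\<^esub> h \<in> carrier (G_stab \<alpha> a b)"
      using grp gh by (simp add: group.is_monoid monoid.m_closed)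
    then have "(a, b, G_stab_act \<alpha> r a b (g \<otimes>\<^bsub>G_stab \<alpha> a b\<^esub> h) \<gamma>)
      = G_act_T \<alpha> r (g \<otimes>\<^bsub>G_group \<alpha>\<^esub> h) (a, b, \<gamma>)"
      using act(1)[OF _ \<gamma>] by (simp only: G_stab_simps(2))
    also have "\<dots> = G_act_T \<alpha> r g (G_act_T \<alpha> r h (a, b, \<gamma>))"
      using T.composition_rule[OF T[OF \<gamma>]] gh by (simp add: G_stab_simps)
    also have "\<dots> = (a, b, G_stab_act \<alpha> r a b g (G_stab_act \<alpha> r a b h \<gamma>))"
      using act gh \<gamma> by simp
    finally show ?thesis by simp
  qed
  show "G_stab_act \<alpha> r a b \<one>\<^bsub>G_stab \<alpha> a b\<^esub> \<gamma> = \<gamma>" if \<gamma>: "\<gamma> \<in> C_quot \<alpha> r a b" for \<gamma>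
  proof -
    have "\<one>\<^bsub>G_stab \<alpha> a b\<^esub> \<in> carrier (G_stab \<alpha> a b)"
      using grp by (simp add: group.is_monoid monoid.one_closed)
    from act(1)[OF this \<gamma>] show ?thesis
      using T.id_eq_one T[OF \<gamma>] by (metis G_stab_simps(3) Pair_inject restrict_apply')
  qed
qed

text \<open>An element carrying one point over \<open>(a, b)\<close> to another automatically
  stabilises \<open>(a, b)\<close>. Hence orbits of the stabiliser are the traces of full orbits on
  the slice.\<close>

lemma G_stab_orbit_eq_iff:
  assumes "S_minus_admissible \<alpha>" "r \<ge> 1" "(a, b) \<in> P_minus \<alpha>"
    and \<gamma>: "\<gamma> \<in> C_quot \<alpha> r a b" and \<gamma>': "\<gamma>' \<in> C_quot \<alpha> r a b"
  shows "orbit (G_stab \<alpha> a b) (G_stab_act \<alpha> r a b) \<gamma> = orbit (G_stab \<alpha> a b) (G_stab_act \<alpha> r a b) \<gamma>'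
    \<longleftrightarrow> (\<exists>g\<in>carrier (G_group \<alpha>). G_act_T \<alpha> r g (a, b, \<gamma>) = (a, b, \<gamma>'))"
proof -
  have "(g \<in> carrier (G_stab \<alpha> a b) \<and> G_stab_act \<alpha> r a b g \<gamma> = \<gamma>')
    \<longleftrightarrow> (g \<in> carrier (G_group \<alpha>) \<and> G_act_T \<alpha> r g (a, b, \<gamma>) = (a, b, \<gamma>'))" for g
  proof
    assume "g \<in> carrier (G_stab \<alpha> a b) \<and> G_stab_act \<alpha> r a b g \<gamma> = \<gamma>'"
    then show "g \<in> carrier (G_group \<alpha>) \<and> G_act_T \<alpha> r g (a, b, \<gamma>) = (a, b, \<gamma>')"
      using G_stab_act_eq(1)[OF assms(1-3) _ \<gamma>] G_stab_simps(1) by blast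
  next
    assume g: "g \<in> carrier (G_group \<alpha>) \<and> G_act_T \<alpha> r g (a, b, \<gamma>) = (a, b, \<gamma>')"
    have "(a, b, \<gamma>) \<in> T_quot \<alpha> r" using assms(3) \<gamma> T_quot_pair_iff by blast
    then have "g \<in> carrier (G_stab \<alpha> a b)"
      using G_act_T_pair[OF assms(1,2) _ g[THEN conjunct1]] g unfolding G_stab_simps
      by (metis Pair_inject prod.collapse)
    then show "g \<in> carrier (G_stab \<alpha> a b) \<and> G_stab_act \<alpha> r a b g \<gamma> = \<gamma>'"
      using G_stab_act_eq(1)[OF assms(1-3) _ \<gamma>] g by simp
  qed
  then show ?thesis
    unfolding group_action.orbit_eq_iff[OF G_stab_group_action[OF assms(1-3)] \<gamma> \<gamma>'] by blast
qed

section \<open>The finite quotient and the positive centraliser\<close>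

lemma NR_lattice_normal: "NR_lattice N r \<lhd> add_group"
proof (rule add_group_normal)
  have "(0 :: int^2) = (mat 1 + N) *v 0 + int r *s 0" by (simp add: vec_eq_iff)
  then show "0 \<in> NR_lattice N r" unfolding NR_lattice_def by blast
next
  fix u v assume "u \<in> NR_lattice N r" "v \<in> NR_lattice N r"
  then obtain x y x' y' where "u = (mat 1 + N) *v x + int r *s y" "v = (mat 1 + N) *v x' + int r *s y'"
    unfolding NR_lattice_def by blast
  then have "u - v = (mat 1 + N) *v (x - x') + int r *s (y - y')"
    by (simp add: vec_eq_iff matrix_vector_mult_def sum_2 algebra_simps)
  then show "u - v \<in> NR_lattice N r" unfolding NR_lattice_def by blast
qed

lemma Z_NR_class_eq_iff: "Z_NR_class N r p = Z_NR_class N r q \<longleftrightarrow> p - q \<in> NR_lattice N r"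
  unfolding Z_NR_class_def by (rule add_group_coset_eq_iff[OF NR_lattice_normal])

lemma Z_NR_carrier: "carrier (Z_NR N r) = range (Z_NR_class N r)"
  by (auto simp: Z_NR_def Z_NR_class_def FactGroup_def RCOSETS_def add_group_def)

lemma matrix_vector_mult_smult: "(K :: int^2^2) *v (t *s x) = t *s (K *v x)"
  by (simp add: vec_eq_iff matrix_vector_mult_def sum_2 algebra_simps)

lemma commute_mult:
  fixes K L N :: "int^2^2"
  assumes "K ** N = N ** K" "L ** N = N ** L"
  shows "K ** L ** N = N ** (K ** L)"
proof -
  have "K ** L ** N = K ** N ** L" using assms(2) by (simp flip: matrix_mul_assoc)
  then show ?thesis using assms(1) by (simp add: matrix_mul_assoc)
qed

lemma commute_matrix_inv:
  fixes K N :: "int^2^2"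
  assumes "invertible K" "K ** N = N ** K"
  shows "matrix_inv K ** N = N ** matrix_inv K"
proof -
  note inv = invertible_int_inverses[OF assms(1)]
  have "matrix_inv K ** N = matrix_inv K ** (N ** K) ** matrix_inv K"
    by (simp add: inv flip: matrix_mul_assoc)
  also have "\<dots> = (matrix_inv K ** K) ** N ** matrix_inv K"
    by (simp only: matrix_mul_assoc flip: assms(2))
  also have "\<dots> = N ** matrix_inv K" by (simp add: inv)
  finally show ?thesis .
qed

text \<open>Matrices commuting with N preserve (I + N) Z^2. Using this for \<open>K\<close> and for
  its inverse gives equality, which is what makes the image of a coset a coset.\<close>

lemma NR_lattice_image:
  assumes "invertible K" "K ** N = N ** K"
  shows "(\<lambda>p. det K *s (K *v p)) ` NR_lattice N r = NR_lattice N r"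
proof -
  have into: "det L *s (L *v p) \<in> NR_lattice N r"
    if L: "L ** N = N ** L" and p: "p \<in> NR_lattice N r" for L p
  proof -
    obtain x y where xy: "p = (mat 1 + N) *v x + int r *s y" using p unfolding NR_lattice_def by blast
    have "L *v (N *v x) = N *v (L *v x)" using L by (simp add: matrix_vector_mul_assoc)
    moreover have "p = x + N *v x + int r *s y" by (simp add: xy matrix_vector_mult_add_rdistrib)
    ultimately have "det L *s (L *v p) = (mat 1 + N) *v (det L *s (L *v x)) + int r *s (det L *s (L *v y))"
      by (simp add: matrix_vector_right_distrib matrix_vector_mult_add_rdistrib
          vector_add_ldistrib matrix_vector_mult_smult vector_smult_assoc mult.commute flip: matrix_vector_mul_assoc)
    then show ?thesis unfolding NR_lattice_def by blast
  qed
  let ?L = "matrix_inv K"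
  note inv = invertible_int_inverses[OF assms(1)]
  have L: "?L ** N = N ** ?L" by (rule commute_matrix_inv[OF assms])
  have "det K * det ?L = 1" using inv(1) by (metis det_I det_mul)
  \<comment> \<open>Explicit preimage of \<open>p\<close>; the two determinants cancel.\<close>
  then have "p = det K *s (K *v (det ?L *s (?L *v p)))" for p
    by (simp add: matrix_vector_mult_smult vector_smult_assoc matrix_vector_mul_assoc inv)
  then show ?thesis using into[OF assms(2)] into[OF L] by blast
qed

lemma Z_NR_act_class:
  assumes "invertible K" "K ** N = N ** K"
  shows "Z_NR_act N r K (Z_NR_class N r p) = Z_NR_class N r (det K *s (K *v p))"
proof -
  have "(\<lambda>p. det K *s (K *v p)) ` Z_NR_class N r p
      = {h + det K *s (K *v p) |h. h \<in> (\<lambda>p. det K *s (K *v p)) ` NR_lattice N r}"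
    unfolding Z_NR_class_def add_group_coset Setcompr_eq_image image_image
    by (simp add: matrix_vector_right_distrib vector_add_ldistrib)
  then show ?thesis
    unfolding NR_lattice_image[OF assms]
    by (simp add: Z_NR_act_def Z_NR_carrier Z_NR_class_def add_group_coset)
qed

lemma pos_centralizer_simps:
  "K \<in> carrier (pos_centralizer N a) \<longleftrightarrow>
     invertible K \<and> K ** N = N ** K \<and> (\<exists>t>0. mat_of_int K *v a = t *\<^sub>R a)"
  "K \<otimes>\<^bsub>pos_centralizer N a\<^esub> L = K ** L" "\<one>\<^bsub>pos_centralizer N a\<^esub> = mat 1"
  by (simp_all add: pos_centralizer_def GL2Z_def)

lemma pos_centralizer_group: "group (pos_centralizer N a)"
proof (rule groupI)
  show "\<one>\<^bsub>pos_centralizer N a\<^esub> \<in> carrier (pos_centralizer N a)"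
    by (auto simp: pos_centralizer_simps invertible_int_one mat_of_int_one intro: exI[of _ 1])
next
  fix K L assume K: "K \<in> carrier (pos_centralizer N a)" and L: "L \<in> carrier (pos_centralizer N a)"
  then obtain s t where st: "s > 0" "mat_of_int K *v a = s *\<^sub>R a" "t > 0" "mat_of_int L *v a = t *\<^sub>R a"
    by (auto simp: pos_centralizer_simps)
  then have "mat_of_int (K ** L) *v a = (t * s) *\<^sub>R a"
    by (simp add: mat_of_int_mult matrix_vector_mult_scaleR flip: matrix_vector_mul_assoc)
  moreover have "t * s > 0" using st by simp
  moreover have "K ** L ** N = N ** (K ** L)"
    by (rule commute_mult) (use K L in \<open>auto simp: pos_centralizer_simps\<close>)
  ultimately show "K \<otimes>\<^bsub>pos_centralizer N a\<^esub> L \<in> carrier (pos_centralizer N a)"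
    using K L invertible_int_mult unfolding pos_centralizer_simps by blast
next
  fix K assume K: "K \<in> carrier (pos_centralizer N a)"
  then obtain t where t: "t > 0" "mat_of_int K *v a = t *\<^sub>R a" and inv: "invertible K"
    by (auto simp: pos_centralizer_simps)
  let ?L = "matrix_inv K"
  note I = invertible_int_inverses[OF inv]
  have L: "?L ** N = N ** ?L"
    using K by (simp add: commute_matrix_inv pos_centralizer_simps)
  have "a = mat_of_int ?L *v (t *\<^sub>R a)"
    using invertible_int_mat_of_int_cancel(1)[OF inv, of a] t(2) by simp
  then have "(1 / t) *\<^sub>R a = (1 / t) *\<^sub>R (t *\<^sub>R (mat_of_int ?L *v a))"
    by (metis matrix_vector_mult_scaleR)
  then have "mat_of_int ?L *v a = (1 / t) *\<^sub>R a" using t(1) by simp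
  then have "?L \<in> carrier (pos_centralizer N a)"
    unfolding pos_centralizer_simps using I(3) L t(1) by (metis zero_less_divide_1_iff)
  then show "\<exists>L\<in>carrier (pos_centralizer N a). L \<otimes>\<^bsub>pos_centralizer N a\<^esub> K = \<one>\<^bsub>pos_centralizer N a\<^esub>"
    unfolding pos_centralizer_simps(2,3) using I(2) by blast
qed (simp_all add: pos_centralizer_simps matrix_mul_assoc)

text \<open>The determinant is multiplicative, so \<open>K\<close> twisted by \<open>det K\<close>
  still respects products.\<close>

lemma pos_centralizer_group_action:
  "group_action (pos_centralizer N a) (carrier (Z_NR N r)) (Z_NR_act N r)"
proof (rule group_actionI[OF pos_centralizer_group])
  fix K \<pi> assume "K \<in> carrier (pos_centralizer N a)" "\<pi> \<in> carrier (Z_NR N r)"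
  then show "Z_NR_act N r K \<pi> \<in> carrier (Z_NR N r)"
    by (auto simp: Z_NR_carrier pos_centralizer_simps Z_NR_act_class)
next
  fix K show "Z_NR_act N r K \<in> extensional (carrier (Z_NR N r))" by (simp add: Z_NR_act_def)
next
  fix K L \<pi> assume KL: "K \<in> carrier (pos_centralizer N a)" "L \<in> carrier (pos_centralizer N a)"
    and "\<pi> \<in> carrier (Z_NR N r)"
  then obtain p where p: "\<pi> = Z_NR_class N r p" by (auto simp: Z_NR_carrier)
  have "invertible (K ** L)" "K ** L ** N = N ** (K ** L)"
    using KL by (auto simp: pos_centralizer_simps intro: invertible_int_mult commute_mult)
  then show "Z_NR_act N r (K \<otimes>\<^bsub>pos_centralizer N a\<^esub> L) \<pi> = Z_NR_act N r K (Z_NR_act N r L \<pi>)"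
    using KL by (simp add: p pos_centralizer_simps Z_NR_act_class det_mul matrix_vector_mult_smult vector_smult_assoc
        matrix_vector_mul_assoc mult.commute)
next
  fix \<pi> assume "\<pi> \<in> carrier (Z_NR N r)"
  then show "Z_NR_act N r \<one>\<^bsub>pos_centralizer N a\<^esub> \<pi> = \<pi>"
    by (auto simp: Z_NR_carrier pos_centralizer_simps Z_NR_act_class invertible_int_one)
qed

section \<open>Comparison of the two orbit relations\<close>

text \<open>The three sources of freedom match: \<open>K\<close> gives the centraliser action,
  translations together with half-integral defects give r Z^2, and changing the representative of a
  class gives (I + N) Z^2.\<close>

lemma G_orbit_iff_p_orbit:
  assumes adm: "S_minus_admissible \<alpha>" and P: "(a, b) \<in> P_minus \<alpha>" and r: "r \<ge> 1"
    and cp: "c_equation \<alpha> r a b c p" "c_equation \<alpha> r a b c' p'"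
  shows "(\<exists>g\<in>carrier (G_group \<alpha>). G_act_T \<alpha> r g (a, b, c_class r a b c) = (a, b, c_class r a b c'))
    \<longleftrightarrow> (\<exists>K\<in>carrier (pos_centralizer (N_of \<alpha> a b) a). det K *s (K *v p) - p' \<in> NR_lattice (N_of \<alpha> a b) r)"
    (is "?L \<longleftrightarrow> ?R")
proof -
  define N where "N = N_of \<alpha> a b"
  have \<alpha>: "\<alpha> > 1" "\<alpha> > 0" "\<alpha> \<noteq> 0" using admissible_gt_1[OF adm] by auto
  note w = P_minus_facts(1)[OF \<alpha>(3) P]
  have c: "c \<in> C_set \<alpha> r a b" using cp(1) by (auto simp: C_set_def)
  show ?thesis
  proof
    assume ?L
    then obtain h where h: "h \<in> carrier (G_group \<alpha>)"
      and e: "G_act_T \<alpha> r h (a, b, c_class r a b c) = (a, b, c_class r a b c')" by blast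
    from h obtain \<mu> \<rho> K k where hK: "h = G_elt_of \<alpha> \<mu> \<rho> K k" and g: "\<mu> > 0" "\<rho> \<noteq> 0" "invertible K"
      unfolding G_group_carrier by blast
    have Ka: "\<mu> *\<^sub>R (mat_of_int K *v a) = a" and Kb: "\<rho> *\<^sub>R (mat_of_int K *v b) = b"
      and cl: "c_class r a b c' = c_class r a b (c_act \<alpha> \<mu> \<rho> K k a b c)"
      using e unfolding hK G_act_T_class[OF adm P r c g(3,1,2)] by auto
    obtain m where m: "c_equation \<alpha> r a b (c_act \<alpha> \<mu> \<rho> K k a b c) (det K *s (K *v p) + int r *s m)"
      using c_equation_act[OF \<alpha>(1) P r g(3) _ g(2) cp(1), of \<mu> k] g(1) unfolding Ka Kb by auto
    obtain x where "c' = c_act \<alpha> \<mu> \<rho> K k a b c + (wedge b a / real r) *\<^sub>R vec_of_int x"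
      using cl unfolding c_class_eq_iff by blast
    then have "p' = det K *s (K *v p) + int r *s m - (mat 1 + N) *v x"
      using c_equation_p_unique[OF w r c_equation_lattice[OF m]] cp(2) unfolding N_def by blast
    then have "det K *s (K *v p) - p' = (mat 1 + N) *v x + int r *s (- m)"
      by (simp add: vec_eq_iff)
    then have "det K *s (K *v p) - p' \<in> NR_lattice N r" unfolding NR_lattice_def by blast
    moreover have "K \<in> carrier (pos_centralizer N a)"
    proof -
      \<comment> \<open>The group element fixes the pair and therefore its matrix; the positivity of
        \<mu> supplies the sign condition on \<open>a\<close>.\<close>
      have "K ** N ** matrix_inv K = N"
        using P_minus_action(2)[OF \<alpha>(3) P g(3) _ g(2), of \<mu>] g(1) unfolding Ka Kb N_def by simp
      then have "K ** N = N ** K"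
        using invertible_int_inverses(2)[OF g(3)] by (metis matrix_mul_assoc matrix_mul_rid)
      moreover have "mat_of_int K *v a = (1 / \<mu>) *\<^sub>R a"
        using arg_cong[OF Ka, of "\<lambda>x. (1 / \<mu>) *\<^sub>R x"] g(1) by simp
      ultimately show ?thesis unfolding pos_centralizer_simps using g by (metis zero_less_divide_1_iff)
    qed
    ultimately show ?R unfolding N_def by blast
  next
    assume ?R
    then obtain K where K: "K \<in> carrier (pos_centralizer N a)" and "det K *s (K *v p) - p' \<in> NR_lattice N r"
      unfolding N_def by blast
    then obtain x y where xy: "det K *s (K *v p) - p' = (mat 1 + N) *v x + int r *s y"
      unfolding NR_lattice_def by blast
    obtain t where t: "t > 0" "mat_of_int K *v a = t *\<^sub>R a" and K': "invertible K" "K ** N = N ** K"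
      using K by (auto simp: pos_centralizer_simps)
    \<comment> \<open>The eigenvalue on \<open>b\<close> may be negative; the second scaling factor
      can undo either sign.\<close>
    obtain s where s: "s \<noteq> 0" "mat_of_int K *v b = s *\<^sub>R b"
      using commuting_eigenvectors[OF \<alpha>(2) P K'(1)] K'(2) N_def by metis
    have Ka: "(1 / t) *\<^sub>R (mat_of_int K *v a) = a" and Kb: "(1 / s) *\<^sub>R (mat_of_int K *v b) = b"
      using s t by simp_all
    have ts: "1 / t > 0" "1 / t \<noteq> 0" "1 / s \<noteq> 0" using s t by simp_all
    define c1 where "c1 = c_act \<alpha> (1 / t) (1 / s) K 0 a b c"
    obtain m where m: "c_equation \<alpha> r a b c1 (det K *s (K *v p) + int r *s m)"
      using c_equation_act[OF \<alpha>(1) P r K'(1) ts(2,3) cp(1), of 0] unfolding Ka Kb c1_def by blast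
    then have c1: "c1 \<in> C_set \<alpha> r a b" by (auto simp: C_set_def)
    \<comment> \<open>Here \<open>y\<close> is the r Z^2 part of the given difference and
      \<open>m\<close> the error left by \<open>K\<close>; the translation is chosen to remove
      both.\<close>
    define k :: "int^2" where "k = vector [- (- (y + m))$2, (- (y + m))$1]"
    have rk: "rot k = - (y + m)" unfolding k_def by (rule rot_onto)
    define c2 where "c2 = trans_rep \<alpha> k a b c1"
    have "c_equation \<alpha> r a b c2 (det K *s (K *v p) + int r *s m + int r *s rot k)"
      unfolding c2_def by (rule c_equation_trans[OF \<alpha>(1) P r m])
    from c_equation_lattice[OF this, of x]
    have "c_equation \<alpha> r a b (c2 + (wedge b a / real r) *\<^sub>R vec_of_int x) 
      (det K *s (K *v p) + int r *s m + int r *s rot k - (mat 1 + N) *v x)"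
      unfolding N_def .
    moreover have "det K *s (K *v p) + int r *s m + int r *s rot k - (mat 1 + N) *v x = p'"
    proof -
      have "det K *s (K *v p) = p' + (mat 1 + N) *v x + int r *s y"
        using xy by (simp add: algebra_simps)
      then show ?thesis unfolding rk by (simp add: vec_eq_iff algebra_simps)
    qed
    \<comment> \<open>Both vectors solve the equation for \<open>p'\<close>, which has only one
      solution.\<close>
    ultimately have "c' = c2 + (wedge b a / real r) *\<^sub>R vec_of_int x"
      using c_equation_c_unique[OF \<alpha>(1) P] cp(2) by metis
    then have cl: "c_class r a b c' = c_class r a b c2" unfolding c_class_eq_iff by blast
    have g1: "G_act_T \<alpha> r (G_elt_of \<alpha> (1 / t) (1 / s) K 0) (a, b, c_class r a b c) = (a, b, c_class r a b c1)"
      unfolding G_act_T_class[OF adm P r c K'(1) ts(1,3)] Ka Kb c1_def ..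
    have g2: "G_act_T \<alpha> r (G_elt_of \<alpha> 1 1 (mat 1) k) (a, b, c_class r a b c1) = (a, b, c_class r a b c')"
      using G_act_T_class[OF adm P r c1 invertible_int_one, of 1 1 k]
      by (simp add: mat_of_int_one c_act_def GL_rep_one cl c2_def)
    have G: "G_elt_of \<alpha> (1 / t) (1 / s) K 0 \<in> carrier (G_group \<alpha>)" "G_elt_of \<alpha> 1 1 (mat 1) k \<in> carrier (G_group \<alpha>)"
      unfolding G_group_carrier using ts K'(1) invertible_int_one zero_less_one zero_neq_one by metis+
    interpret T: group_action "G_group \<alpha>" "T_quot \<alpha> r" "G_act_T \<alpha> r"
      by (rule G_act_T_group_action[OF adm r])
    interpret G: group "G_group \<alpha>" by (rule G_group_group)
    have "(a, b, c_class r a b c) \<in> T_quot \<alpha> r" using P c T_quot_iff by blast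
    from T.composition_rule[OF this G(2,1)] show ?L
      unfolding g1 g2 using G.m_closed[OF G(2,1)] by blast
  qed
qed

section \<open>The three orbit sets as images of \<open>C_set\<close>\<close>

lemma G_stab_orbits_eq:
  "(\<lambda>c. orbit (G_stab \<alpha> a b) (G_stab_act \<alpha> r a b) (c_class r a b c)) ` C_set \<alpha> r a b
    = orbits (G_stab \<alpha> a b) (C_quot \<alpha> r a b) (G_stab_act \<alpha> r a b)"
  by (auto simp: orbits_def C_quot_def)

lemma Q_class_eq_iff:
  assumes "S_minus_admissible \<alpha>" "r \<ge> 1" "x \<in> T_quot \<alpha> r" "y \<in> T_quot \<alpha> r"
  shows "Q_class \<alpha> r x = Q_class \<alpha> r y \<longleftrightarrow> (\<exists>g\<in>carrier (G_group \<alpha>). G_act_T \<alpha> r g x = y)"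
  unfolding Q_class_def by (rule group_action.orbit_eq_iff[OF G_act_T_group_action[OF assms(1,2)] assms(3,4)])

text \<open>A point whose pair is merely equivalent to \<open>(a, b)\<close> can be moved within its
  orbit until its pair equals \<open>(a, b)\<close>.\<close>

lemma Q_class_image_eq_Phi_fibre:
  assumes "S_minus_admissible \<alpha>" "r \<ge> 1" "(a, b) \<in> P_minus \<alpha>"
  shows "(\<lambda>c. Q_class \<alpha> r (a, b, c_class r a b c)) ` C_set \<alpha> r a b = Phi_fibre \<alpha> r (P_class \<alpha> (a, b))"
proof (intro equalityI subsetI)
  fix \<omega> assume "\<omega> \<in> (\<lambda>c. Q_class \<alpha> r (a, b, c_class r a b c)) ` C_set \<alpha> r a b"
  then obtain c where c: "c \<in> C_set \<alpha> r a b" "\<omega> = Q_class \<alpha> r (a, b, c_class r a b c)" by blast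
  then have x: "(a, b, c_class r a b c) \<in> T_quot \<alpha> r" using assms(3) T_quot_iff by blast
  then have "\<omega> \<in> Q_minus \<alpha> r" unfolding c(2) Q_minus_def orbits_def Q_class_def by blast
  then show "\<omega> \<in> Phi_fibre \<alpha> r (P_class \<alpha> (a, b))"
    using Phi_Q_class[OF assms(1,2) x] by (simp add: Phi_fibre_def c(2))
next
  fix \<omega> assume \<omega>: "\<omega> \<in> Phi_fibre \<alpha> r (P_class \<alpha> (a, b))"
  then obtain a' b' \<gamma> where x: "(a', b', \<gamma>) \<in> T_quot \<alpha> r" "\<omega> = Q_class \<alpha> r (a', b', \<gamma>)"
    unfolding Phi_fibre_def Q_minus_def orbits_def Q_class_def by auto
  then have "P_class \<alpha> (a', b') = P_class \<alpha> (a, b)"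
    using \<omega> Phi_Q_class[OF assms(1,2) x(1)] by (simp add: Phi_fibre_def)
  moreover have "(a', b') \<in> P_minus \<alpha>" using x(1) T_quot_pair_iff by blast
  moreover have "\<alpha> \<noteq> 0" using admissible_gt_1[OF assms(1)] by simp
  ultimately obtain g where g: "g \<in> carrier (G_group \<alpha>)" "G_act_P \<alpha> g (a', b') = (a, b)"
    using group_action.orbit_eq_iff[OF G_act_P_group_action] assms(3) unfolding P_class_def by blast
  then obtain \<gamma>' where \<gamma>': "G_act_T \<alpha> r g (a', b', \<gamma>) = (a, b, \<gamma>')"
    using G_act_T_pair[OF assms(1,2) x(1) g(1)] by (metis fst_conv snd_conv)
  then have x': "(a, b, \<gamma>') \<in> T_quot \<alpha> r"
    using group_action.element_image[OF G_act_T_group_action[OF assms(1,2)] g(1) x(1)] by blast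
  then obtain c where c: "c \<in> C_set \<alpha> r a b" "\<gamma>' = c_class r a b c"
    unfolding T_quot_pair_iff C_quot_def by blast
  have "\<omega> = Q_class \<alpha> r (a, b, \<gamma>')"
    unfolding x(2) Q_class_eq_iff[OF assms(1,2) x(1) x'] using g(1) \<gamma>' by blast
  then show "\<omega> \<in> (\<lambda>c. Q_class \<alpha> r (a, b, c_class r a b c)) ` C_set \<alpha> r a b"
    using c by blast
qed

text \<open>Every integer vector is the \<open>p\<close> of some \<open>c\<close>, so every class
  modulo the lattice is reached.\<close>

lemma pos_centralizer_orbits_eq:
  assumes "S_minus_admissible \<alpha>" "r \<ge> 1" "(a, b) \<in> P_minus \<alpha>"
  shows "(\<lambda>c. orbit (pos_centralizer N a) (Z_NR_act N r) (Z_NR_class N r (p_of \<alpha> r a b c))) ` C_set \<alpha> r a b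
    = orbits (pos_centralizer N a) (carrier (Z_NR N r)) (Z_NR_act N r)"
proof -
  have \<alpha>: "\<alpha> > 1" "\<alpha> \<noteq> 0" using admissible_gt_1[OF assms(1)] by auto
  have "p \<in> p_of \<alpha> r a b ` C_set \<alpha> r a b" for p
  proof -
    obtain c where c: "c_equation \<alpha> r a b c p" using c_equation_ex[OF \<alpha>(1) assms(3)] by blast
    then have "p = p_of \<alpha> r a b c" using p_of_eq[OF P_minus_facts(1)[OF \<alpha>(2) assms(3)] assms(2)] by simp
    then show ?thesis using c by (auto simp: C_set_def)
  qed
  then have "p_of \<alpha> r a b ` C_set \<alpha> r a b = UNIV" by blast
  then have "carrier (Z_NR N r) = (\<lambda>c. Z_NR_class N r (p_of \<alpha> r a b c)) ` C_set \<alpha> r a b"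
    unfolding Z_NR_carrier by (metis image_image)
  then show ?thesis unfolding orbits_def by auto
qed

theorem theorem4p42:
  fixes \<alpha> :: real and a b :: "real^2" and r :: nat and N :: "int^2^2"
  assumes "S_minus_admissible \<alpha>"
    and "(a, b) \<in> P_minus \<alpha>"
    and "r \<ge> 1"
    and "N = N_of \<alpha> a b"
  shows
    "Phi_fibre \<alpha> r (P_class \<alpha> (a, b)) = Psi_fibre \<alpha> r (N_class \<alpha> N)
     \<and> connected_components_of
          (subtopology (Q_minus_top \<alpha> r) (Phi_fibre \<alpha> r (P_class \<alpha> (a, b))))
        = (\<lambda>\<omega>. {\<omega>}) ` Phi_fibre \<alpha> r (P_class \<alpha> (a, b))
     \<and> group_action (G_stab \<alpha> a b) (C_quot \<alpha> r a b) (G_stab_act \<alpha> r a b)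
     \<and> (\<exists>f. bij_betw f
               (orbits (G_stab \<alpha> a b) (C_quot \<alpha> r a b) (G_stab_act \<alpha> r a b))
               (Phi_fibre \<alpha> r (P_class \<alpha> (a, b)))
            \<and> bij_betw (\<lambda>\<O>. {f \<O>})
               (orbits (G_stab \<alpha> a b) (C_quot \<alpha> r a b) (G_stab_act \<alpha> r a b))
               (connected_components_of
                  (subtopology (Q_minus_top \<alpha> r) (Phi_fibre \<alpha> r (P_class \<alpha> (a, b)))))
            \<and> (\<forall>c\<in>C_set \<alpha> r a b.
                  f (orbit (G_stab \<alpha> a b) (G_stab_act \<alpha> r a b) (c_class r a b c))
                  = Q_class \<alpha> r (a, b, c_class r a b c)))
     \<and> group_action (pos_centralizer N a) (carrier (Z_NR N r)) (Z_NR_act N r)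
     \<and> (\<forall>K\<in>carrier (pos_centralizer N a). \<forall>p.
          Z_NR_act N r K (Z_NR_class N r p) = Z_NR_class N r (det K *s (K *v p)))
     \<and> (\<exists>F. bij_betw F
               (orbits (G_stab \<alpha> a b) (C_quot \<alpha> r a b) (G_stab_act \<alpha> r a b))
               (orbits (pos_centralizer N a) (carrier (Z_NR N r)) (Z_NR_act N r))
            \<and> (\<forall>c\<in>C_set \<alpha> r a b.
                  F (orbit (G_stab \<alpha> a b) (G_stab_act \<alpha> r a b) (c_class r a b c))
                  = orbit (pos_centralizer N a) (Z_NR_act N r)
                      (Z_NR_class N r (p_of \<alpha> r a b c))))"
proof (intro conjI)
  note comp = connected_components_Phi_fibre[OF assms(1,3)]
  have \<alpha>: "\<alpha> \<noteq> 0" using admissible_gt_1[OF assms(1)] by simp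
  \<comment> \<open>Common to both bijections: it reduces the stabiliser orbits to the full group
    action.\<close>
  have orbit_iff: "orbit (G_stab \<alpha> a b) (G_stab_act \<alpha> r a b) (c_class r a b c)
      = orbit (G_stab \<alpha> a b) (G_stab_act \<alpha> r a b) (c_class r a b c')
    \<longleftrightarrow> (\<exists>g\<in>carrier (G_group \<alpha>). G_act_T \<alpha> r g (a, b, c_class r a b c) = (a, b, c_class r a b c'))"
    if "c \<in> C_set \<alpha> r a b" "c' \<in> C_set \<alpha> r a b" for c c'
    by (rule G_stab_orbit_eq_iff[OF assms(1,3,2)]) (use that in \<open>auto simp: C_quot_def\<close>)
  show "Phi_fibre \<alpha> r (P_class \<alpha> (a, b)) = Psi_fibre \<alpha> r (N_class \<alpha> N)"
    unfolding assms(4) by (rule Phi_fibre_eq_Psi_fibre[OF assms(1,3,2)])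
  show "connected_components_of (subtopology (Q_minus_top \<alpha> r) (Phi_fibre \<alpha> r (P_class \<alpha> (a, b))))
      = (\<lambda>\<omega>. {\<omega>}) ` Phi_fibre \<alpha> r (P_class \<alpha> (a, b))"
    by (rule comp)
  show "group_action (G_stab \<alpha> a b) (C_quot \<alpha> r a b) (G_stab_act \<alpha> r a b)"
    by (rule G_stab_group_action[OF assms(1,3,2)])
  show "group_action (pos_centralizer N a) (carrier (Z_NR N r)) (Z_NR_act N r)"
    by (rule pos_centralizer_group_action)
  show "\<forall>K\<in>carrier (pos_centralizer N a). \<forall>p.
      Z_NR_act N r K (Z_NR_class N r p) = Z_NR_class N r (det K *s (K *v p))"
    by (auto simp: pos_centralizer_simps Z_NR_act_class)
  have "\<exists>f. bij_betw f (orbits (G_stab \<alpha> a b) (C_quot \<alpha> r a b) (G_stab_act \<alpha> r a b))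
        (Phi_fibre \<alpha> r (P_class \<alpha> (a, b)))
      \<and> (\<forall>c\<in>C_set \<alpha> r a b. f (orbit (G_stab \<alpha> a b) (G_stab_act \<alpha> r a b) (c_class r a b c))
          = Q_class \<alpha> r (a, b, c_class r a b c))"
  proof (rule ex_bij_betw_of_same_kernel[OF G_stab_orbits_eq Q_class_image_eq_Phi_fibre[OF assms(1,3,2)]])
    fix c c' assume c: "c \<in> C_set \<alpha> r a b" "c' \<in> C_set \<alpha> r a b"
    have "(a, b, c_class r a b c) \<in> T_quot \<alpha> r" "(a, b, c_class r a b c') \<in> T_quot \<alpha> r"
      using c assms(2) T_quot_iff by blast+
    from Q_class_eq_iff[OF assms(1,3) this] orbit_iff[OF c]
    show "orbit (G_stab \<alpha> a b) (G_stab_act \<alpha> r a b) (c_class r a b c)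
      = orbit (G_stab \<alpha> a b) (G_stab_act \<alpha> r a b) (c_class r a b c')
      \<longleftrightarrow> Q_class \<alpha> r (a, b, c_class r a b c) = Q_class \<alpha> r (a, b, c_class r a b c')" by simp
  qed
  then obtain f where f: "bij_betw f (orbits (G_stab \<alpha> a b) (C_quot \<alpha> r a b) (G_stab_act \<alpha> r a b))
        (Phi_fibre \<alpha> r (P_class \<alpha> (a, b)))"
      "\<forall>c\<in>C_set \<alpha> r a b. f (orbit (G_stab \<alpha> a b) (G_stab_act \<alpha> r a b) (c_class r a b c))
          = Q_class \<alpha> r (a, b, c_class r a b c)" by blast
  \<comment> \<open>The components are singletons, so composing \<open>f\<close> with the singleton
    map parameterises them.\<close>
  have "bij_betw (\<lambda>\<omega>. {\<omega>}) (Phi_fibre \<alpha> r (P_class \<alpha> (a, b))) ((\<lambda>\<omega>. {\<omega>}) ` Phi_fibre \<alpha> r (P_class \<alpha> (a, b)))"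
    by (simp add: bij_betw_def inj_on_def)
  from bij_betw_trans[OF f(1) this]
  have "bij_betw (\<lambda>\<O>. {f \<O>}) (orbits (G_stab \<alpha> a b) (C_quot \<alpha> r a b) (G_stab_act \<alpha> r a b))
      (connected_components_of (subtopology (Q_minus_top \<alpha> r) (Phi_fibre \<alpha> r (P_class \<alpha> (a, b)))))"
    unfolding comp by (simp add: comp_def)
  with f show "\<exists>f. bij_betw f
               (orbits (G_stab \<alpha> a b) (C_quot \<alpha> r a b) (G_stab_act \<alpha> r a b))
               (Phi_fibre \<alpha> r (P_class \<alpha> (a, b)))
            \<and> bij_betw (\<lambda>\<O>. {f \<O>})
               (orbits (G_stab \<alpha> a b) (C_quot \<alpha> r a b) (G_stab_act \<alpha> r a b))
               (connected_components_of
                  (subtopology (Q_minus_top \<alpha> r) (Phi_fibre \<alpha> r (P_class \<alpha> (a, b)))))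
            \<and> (\<forall>c\<in>C_set \<alpha> r a b.
                  f (orbit (G_stab \<alpha> a b) (G_stab_act \<alpha> r a b) (c_class r a b c))
                  = Q_class \<alpha> r (a, b, c_class r a b c))" by blast
  show "\<exists>F. bij_betw F
               (orbits (G_stab \<alpha> a b) (C_quot \<alpha> r a b) (G_stab_act \<alpha> r a b))
               (orbits (pos_centralizer N a) (carrier (Z_NR N r)) (Z_NR_act N r))
            \<and> (\<forall>c\<in>C_set \<alpha> r a b.
                  F (orbit (G_stab \<alpha> a b) (G_stab_act \<alpha> r a b) (c_class r a b c))
                  = orbit (pos_centralizer N a) (Z_NR_act N r)
                      (Z_NR_class N r (p_of \<alpha> r a b c)))"
  proof (rule ex_bij_betw_of_same_kernel[OF G_stab_orbits_eq pos_centralizer_orbits_eq[OF assms(1,3,2)]])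
    fix c c' assume c: "c \<in> C_set \<alpha> r a b" "c' \<in> C_set \<alpha> r a b"
    let ?p = "p_of \<alpha> r a b"
    note eq = c_equation_p_of[OF P_minus_facts(1)[OF \<alpha> assms(2)] assms(3)]
    have Z: "Z_NR_class N r p \<in> carrier (Z_NR N r)" for p by (simp add: Z_NR_carrier)
    have "orbit (pos_centralizer N a) (Z_NR_act N r) (Z_NR_class N r (?p c))
        = orbit (pos_centralizer N a) (Z_NR_act N r) (Z_NR_class N r (?p c'))
      \<longleftrightarrow> (\<exists>K\<in>carrier (pos_centralizer N a). Z_NR_act N r K (Z_NR_class N r (?p c)) = Z_NR_class N r (?p c'))"
      by (rule group_action.orbit_eq_iff[OF pos_centralizer_group_action Z Z])
    \<comment> \<open>Equality of classes becomes membership of a difference in the lattice, the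
      form in which the two orbit relations were compared.\<close>
    also have "\<dots> \<longleftrightarrow> (\<exists>K\<in>carrier (pos_centralizer N a). det K *s (K *v ?p c) - ?p c' \<in> NR_lattice N r)"
      by (intro bex_cong refl) (simp add: pos_centralizer_simps Z_NR_act_class Z_NR_class_eq_iff)
    finally show "orbit (G_stab \<alpha> a b) (G_stab_act \<alpha> r a b) (c_class r a b c)
        = orbit (G_stab \<alpha> a b) (G_stab_act \<alpha> r a b) (c_class r a b c')
      \<longleftrightarrow> orbit (pos_centralizer N a) (Z_NR_act N r) (Z_NR_class N r (?p c))
        = orbit (pos_centralizer N a) (Z_NR_act N r) (Z_NR_class N r (?p c'))"
      using orbit_iff[OF c] G_orbit_iff_p_orbit[OF assms(1-3) eq[OF c(1)] eq[OF c(2)]] assms(4) by simp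
  qed
qed

end
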